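(* Let $0<p<1$, let $S_p$ be the transition operator of the stochastic adding machine in base $2$, acting by $v\mapsto S_p v$ on complex sequences viewed as column vectors, and let $J(f)$ be the filled Julia set of the quadratic map $f(z)=\dfrac{(z-(1-p))^2}{p^2}$. Then the spectrum of $S_p$ acting on each of the Banach spaces $c_0$, $c$ and $\ell^{\alpha}$ ($1\le\alpha<\infty$) is equal to $J(f)$. More precisely: (i) for $S_p$ acting on $c_0$, and for $S_p$ acting on $\ell^{\alpha}$ with $1<\alpha<\infty$, the continuous spectrum is equal to $J(f)$, and the point spectrum and the residual spectrum are empty; (ii) for $S_p$ acting on $c$, the point spectrum is equal to $\{1\}$, the residual spectrum is empty, and the continuous spectrum is equal to $J(f)\setminus\{1\}$.
   Context: $\mathbb{N}=\{0,1,2,\dots\}$. The operator $S_p$ is given by the infinite matrix $((S_p)_{n,m})_{n,m\in\mathbb{N}}$ defined as follows: for $n\in\mathbb{N}$ let $s=s(n)\ge 0$ be the number of consecutive digits $1$ at the end (least significant positions) of the binary expansion of $n$, i.e. the largest $s$ such that $2^s$ divides $n+1$. Then $(S_p)_{n,n+1}=p^{s+1}$, $(S_p)_{n,\,n-2^m+1}=p^m(1-p)$ for $0\le m\le s$ (in particular $(S_p)_{n,n}=1-p$), and all other entries of row $n$ are $0$. It acts by $(S_pv)_n=\sum_{m}(S_p)_{n,m}v_m$. $c_0$ is the space of complex sequences indexed by $\mathbb{N}$ converging to $0$, and $c$ the space of convergent complex sequences, both with the sup norm; $\ell^\alpha=\ell^\alpha(\mathbb{N})$ is the usual complex sequence space.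 $S_p$ defines a bounded operator on each of these spaces. For a bounded operator $T$ on a complex Banach space $E$: the spectrum is the set of $\lambda\in\mathbb{C}$ for which $T-\lambda\,\mathrm{Id}$ is not an isomorphism; the point spectrum is the set of $\lambda$ for which $T-\lambda\,\mathrm{Id}$ is not injective; the continuous spectrum is the set of $\lambda$ for which $T-\lambda\,\mathrm{Id}$ is injective, not onto, and has dense range; the residual spectrum is the set of $\lambda$ for which $T-\lambda\,\mathrm{Id}$ is injective and does not have dense range. The filled Julia set is $J(f)=\{z\in\mathbb{C}: (f^{n}(z))_{n\ge 0}\text{ is bounded}\}$, where $f^n$ is the $n$-th iterate of $f$. *)

theory Defs
  imports "HOL-Analysis.Analysis" "HOL-Computational_Algebra.Primes"
begin

section \<open>Normed sequence spaces and spectra\<close>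

text \<open>A type cannot depend on the real exponent of an \<open>\<ell>\<^sup>\<alpha>\<close> space, so a normed space of
  complex sequences is given by its carrier set and its norm.\<close>

record seq_space =
  vecs :: "(nat \<Rightarrow> complex) set"
  nrm :: "(nat \<Rightarrow> complex) \<Rightarrow> real"

definition sup_norm :: "(nat \<Rightarrow> complex) \<Rightarrow> real" where
  "sup_norm v = (SUP n. cmod (v n))"

definition c0_space :: seq_space where
  "c0_space = \<lparr>vecs = {v. v \<longlonglongrightarrow> 0}, nrm = sup_norm\<rparr>"

definition c_space :: seq_space where
  "c_space = \<lparr>vecs = {v. convergent v}, nrm = sup_norm\<rparr>"

definition ell_space :: "real \<Rightarrow> seq_space" where
  "ell_space \<alpha> =
     \<lparr>vecs = {v. summable (\<lambda>n. cmod (v n) powr \<alpha>)},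
      nrm = (\<lambda>v. (\<Sum>n. cmod (v n) powr \<alpha>) powr (1 / \<alpha>))\<rparr>"

type_synonym seq_op = "(nat \<Rightarrow> complex) \<Rightarrow> (nat \<Rightarrow> complex)"

definition bounded_op :: "seq_space \<Rightarrow> seq_op \<Rightarrow> bool" where
  "bounded_op E T \<longleftrightarrow>
     T ` vecs E \<subseteq> vecs E \<and>
     (\<forall>v\<in>vecs E. \<forall>w\<in>vecs E. \<forall>a b.
        T (\<lambda>n. a * v n + b * w n) = (\<lambda>n. a * T v n + b * T w n)) \<and>
     (\<exists>C. \<forall>v\<in>vecs E. nrm E (T v) \<le> C * nrm E v)"

definition isomorphism_op :: "seq_space \<Rightarrow> seq_op \<Rightarrow> bool" where
  "isomorphism_op E T \<longleftrightarrow>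
     bounded_op E T \<and> bij_betw T (vecs E) (vecs E) \<and> bounded_op E (inv_into (vecs E) T)"

definition dense_range :: "seq_space \<Rightarrow> seq_op \<Rightarrow> bool" where
  "dense_range E T \<longleftrightarrow>
     (\<forall>w\<in>vecs E. \<forall>\<epsilon>>0. \<exists>v\<in>vecs E. nrm E (\<lambda>n. T v n - w n) < \<epsilon>)"

definition shift_op :: "seq_op \<Rightarrow> complex \<Rightarrow> seq_op" where
  "shift_op T \<mu> = (\<lambda>v n. T v n - \<mu> * v n)"

text \<open>The following sets are meant for operators \<open>T\<close> that are bounded on \<open>E\<close>. If \<open>T\<close> is not,
  then no \<open>T - \<mu> Id\<close> is an isomorphism, so \<open>op_spectrum E T\<close> is the whole plane.\<close>

definition op_spectrum :: "seq_space \<Rightarrow> seq_op \<Rightarrow> complex set" where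
  "op_spectrum E T = {\<mu>. \<not> isomorphism_op E (shift_op T \<mu>)}"

definition op_point_spectrum :: "seq_space \<Rightarrow> seq_op \<Rightarrow> complex set" where
  "op_point_spectrum E T = {\<mu>. \<not> inj_on (shift_op T \<mu>) (vecs E)}"

definition op_continuous_spectrum :: "seq_space \<Rightarrow> seq_op \<Rightarrow> complex set" where
  "op_continuous_spectrum E T =
     {\<mu>. inj_on (shift_op T \<mu>) (vecs E) \<and> shift_op T \<mu> ` vecs E \<noteq> vecs E \<and>
         dense_range E (shift_op T \<mu>)}"

definition op_residual_spectrum :: "seq_space \<Rightarrow> seq_op \<Rightarrow> complex set" where
  "op_residual_spectrum E T =
     {\<mu>. inj_on (shift_op T \<mu>) (vecs E) \<and> \<not> dense_range E (shift_op T \<mu>)}"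


section \<open>The stochastic adding machine in base 2\<close>

text \<open>The largest \<open>s\<close> such that \<open>2\<^sup>s\<close> divides \<open>n + 1\<close>, i.e. the number of trailing digits 1 in
  the binary expansion of \<open>n\<close>.\<close>

definition trailing_ones :: "nat \<Rightarrow> nat" where
  "trailing_ones n = multiplicity 2 (n + 1)"

text \<open>The column indices \<open>n + 1\<close> and \<open>n + 1 - 2\<^sup>m\<close> for \<open>m \<le> trailing_ones n\<close> are pairwise distinct
  (and the subtraction is not truncated), so at most one of the terms below is nonzero; see the
  lemmas following the definition.\<close>

definition sam_entry :: "real \<Rightarrow> nat \<Rightarrow> nat \<Rightarrow> real" where
  "sam_entry p n k =
     (if k = n + 1 then p ^ (trailing_ones n + 1) else 0) +
     (\<Sum>m\<le>trailing_ones n. if k = n + 1 - 2 ^ m then p ^ m * (1 - p) else 0)"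

lemma two_power_le_Suc:
  assumes "m \<le> trailing_ones n"
  shows "2 ^ m \<le> n + 1"
proof -
  have "2 ^ m dvd n + 1"
    using assms multiplicity_dvd' unfolding trailing_ones_def by blast
  then show ?thesis
    by (rule dvd_imp_le) simp
qed

lemma sam_entry_Suc: "sam_entry p n (n + 1) = p ^ (trailing_ones n + 1)"
proof -
  have "n + 1 \<noteq> n + 1 - 2 ^ m" for m
    using zero_less_power[of "2::nat" m] by linarith
  then show ?thesis
    by (simp add: sam_entry_def)
qed

lemma sam_entry_back:
  assumes "m \<le> trailing_ones n"
  shows "sam_entry p n (n + 1 - 2 ^ m) = p ^ m * (1 - p)"
proof -
  have ne: "n + 1 - 2 ^ m \<noteq> n + 1"
    using zero_less_power[of "2::nat" m] by linarith
  have eq: "n + 1 - 2 ^ m = n + 1 - 2 ^ j \<longleftrightarrow> j = m" if "j \<le> trailing_ones n" for j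
  proof
    assume "n + 1 - 2 ^ m = n + 1 - 2 ^ j"
    then have "(2::nat) ^ j = 2 ^ m"
      using two_power_le_Suc[OF assms] two_power_le_Suc[OF that] by linarith
    then show "j = m" by simp
  qed simp
  have "(\<Sum>j\<le>trailing_ones n. if n + 1 - 2 ^ m = n + 1 - 2 ^ j then p ^ j * (1 - p) else 0) =
        (\<Sum>j\<le>trailing_ones n. if j = m then p ^ j * (1 - p) else 0)"
    by (rule sum.cong[OF refl]) (use eq in auto)
  also have "\<dots> = p ^ m * (1 - p)"
    using assms by simp
  finally show ?thesis
    using ne by (simp only: sam_entry_def if_False add_0_left)
qed

lemma sam_entry_other:
  assumes "k \<noteq> n + 1" "\<And>m. m \<le> trailing_ones n \<Longrightarrow> k \<noteq> n + 1 - 2 ^ m"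
  shows "sam_entry p n k = 0"
  using assms by (simp add: sam_entry_def)

text \<open>Every row of the matrix has finitely many nonzero entries, so the series below always
  converges.\<close>

definition sam_op :: "real \<Rightarrow> seq_op" where
  "sam_op p v = (\<lambda>n. \<Sum>k. complex_of_real (sam_entry p n k) * v k)"


section \<open>The filled Julia set\<close>

definition filled_julia :: "(complex \<Rightarrow> complex) \<Rightarrow> complex set" where
  "filled_julia f = {z. bounded (range (\<lambda>n. (f ^^ n) z))}"

definition sam_map :: "real \<Rightarrow> complex \<Rightarrow> complex" where
  "sam_map p z = (z - (1 - complex_of_real p))\<^sup>2 / (complex_of_real p)\<^sup>2"

end

theory Submission
  imports Defs
begin

text \<open>Write \<open>S\<close> for the operator, \<open>f\<close> for the quadratic map, \<open>z(\<mu>) = (\<mu> - (1 - p)) / p\<close>, and split a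
  sequence into its even part \<open>a\<close> and its odd part \<open>b\<close>. Then \<open>S (a, b) = ((1 - p) a + p b, (1 - p) b + p S a)\<close>,
  so \<open>f(S) = S \<oplus> S\<close>, and \<open>(S - \<mu>) (a, b) = w\<close> is equivalent to
  \<open>b = z(\<mu>) a + w\<^sub>e / p\<close> and \<open>(S - f(\<mu>)) a = (w\<^sub>o + z(\<mu>) w\<^sub>e) / p\<close>, where \<open>w\<^sub>e\<close> and \<open>w\<^sub>o\<close> are the
  parts of \<open>w\<close>.

  Outside the filled Julia set some iterate of \<open>f\<close> leaves the unit disc, where the resolvent exists because
  \<open>S\<close> is a contraction, and the equivalence pulls the resolvent back to \<open>\<mu>\<close>.
  The formal eigenvector is \<open>v\<^sub>n = \<Prod> z(f\<^sup>i(\<mu>))\<close> over the positions \<open>i\<close> of the binary digits 1 of \<open>n\<close>;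
  it never tends to 0, so \<open>S - \<mu>\<close> is injective on null sequences. If \<open>\<mu>\<close> is in the filled Julia
  set, then \<open>v\<close> is bounded by 1, and for \<open>u\<^sub>n = v\<^sub>n \<cdot> bit_length n\<close> the sequence \<open>(S - \<mu>) u\<close> is summable
  but is not the image of any null sequence. Every finitely supported sequence is congruent modulo the
  range to bounded multiples of unit vectors arbitrarily far out, and averaging these gives the dense
  range. On \<open>c\<close> one splits off the constants, which \<open>S\<close> fixes.\<close>

section \<open>The even-odd recursion\<close>

lemma trailing_ones_even: "trailing_ones (2 * k) = 0"
  unfolding trailing_ones_def by (rule not_dvd_imp_multiplicity_0) simp

lemma trailing_ones_odd: "trailing_ones (2 * k + 1) = Suc (trailing_ones k)"
proof -
  have "2 * k + 1 + 1 = 2 * (k + 1)" by simp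
  then show ?thesis
    unfolding trailing_ones_def by (simp only:) (rule multiplicity_times_same, auto)
qed

text \<open>Row n is supported on the columns up to n + 1, so the series is finite and each
  indicator collapses to one term.\<close>

lemma sam_op_finite_sum:
  "sam_op p v n = of_real (p ^ (trailing_ones n + 1)) * v (n + 1)
     + (\<Sum>m\<le>trailing_ones n. of_real (p ^ m * (1 - p)) * v (n + 1 - 2 ^ m))"
proof -
  let ?s = "trailing_ones n"
  have "sam_op p v n = (\<Sum>k\<le>n + 1. complex_of_real (sam_entry p n k) * v k)"
    unfolding sam_op_def
    by (rule suminf_finite) (auto simp: sam_entry_def intro!: sum.neutral)
  also have "\<dots> = (\<Sum>k\<le>n + 1. (if k = n + 1 then of_real (p ^ (?s + 1)) * v k else 0)
      + (\<Sum>m\<le>?s. if k = n + 1 - 2 ^ m then of_real (p ^ m * (1 - p)) * v k else 0))"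
    by (intro sum.cong refl)
      (simp add: sam_entry_def distrib_right sum_distrib_right of_real_sum if_distrib[of of_real]
        if_distrib[of "\<lambda>x. x * _"] cong: if_cong)
  also have "\<dots> = of_real (p ^ (?s + 1)) * v (n + 1)
      + (\<Sum>m\<le>?s. \<Sum>k\<le>n + 1. if k = n + 1 - 2 ^ m then of_real (p ^ m * (1 - p)) * v k else 0)"
    unfolding sum.distrib by (rule arg_cong2[where f = "(+)", OF _ sum.swap]) simp
  also have "\<dots> = of_real (p ^ (?s + 1)) * v (n + 1)
      + (\<Sum>m\<le>?s. of_real (p ^ m * (1 - p)) * v (n + 1 - 2 ^ m))"
    by (simp only: sum.delta finite_atMost atMost_iff diff_le_self if_True)
  finally show ?thesis .
qed

lemma sam_op_even: "sam_op p v (2 * k) = (1 - of_real p) * v (2 * k) + of_real p * v (2 * k + 1)"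
  by (simp add: sam_op_finite_sum trailing_ones_even)

text \<open>Row 2k + 1 has one trailing digit 1 more than row k. Its term m = 0 is the diagonal; its
  other columns are twice those of row k, each weight gaining a factor p.\<close>

lemma sam_op_odd:
  "sam_op p v (2 * k + 1) =
     (1 - of_real p) * v (2 * k + 1) + of_real p * sam_op p (\<lambda>j. v (2 * j)) k"
proof -
  have idx: "2 * k + 1 + 1 - 2 ^ Suc m = 2 * (k + 1 - 2 ^ m)" for m by (simp add: diff_mult_distrib2)
  show ?thesis
    unfolding sam_op_finite_sum[of p v] trailing_ones_odd sum.atMost_Suc_shift idx
    by (simp add: sam_op_finite_sum sum_distrib_left algebra_simps)
qed

text \<open>Shaped after the recursion of S: row 2k + 1 reduces to row k applied to the even part,
  so most inductions below generalise over the sequence.\<close>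

lemma nat_binary_induct [case_names even odd]:
  assumes "\<And>k. (\<And>j. j < 2 * k \<Longrightarrow> P j) \<Longrightarrow> P (2 * k)"
    and "\<And>k. P k \<Longrightarrow> P (2 * k + 1)"
  shows "P (n::nat)"
proof (induction n rule: less_induct)
  case (less n)
  show ?case
  proof (cases "even n")
    case True
    then obtain k where "n = 2 * k" by blast
    with less assms(1) show ?thesis by blast
  next
    case False
    then obtain k where "n = 2 * k + 1" using oddE by blast
    with less assms(2) show ?thesis by simp
  qed
qed

lemma sam_op_lincomb:
  "sam_op p (\<lambda>n. a * v n + b * w n) n = a * sam_op p v n + b * sam_op p w n"
proof (induction n arbitrary: v w rule: nat_binary_induct)
  case (even k)
  show ?case by (simp only: sam_op_even) algebra
next
  case (odd k)
  show ?case by (simp only: sam_op_odd odd) algebra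
qed

lemma sam_op_const: "sam_op p (\<lambda>n. c) n = c"
proof (induction n rule: nat_binary_induct)
  case (even k)
  show ?case by (simp only: sam_op_even) (simp add: algebra_simps)
next
  case (odd k)
  show ?case by (simp only: sam_op_odd odd) (simp add: algebra_simps)
qed

text \<open>Each output entry involves finitely many input entries, so pointwise convergence
  suffices. This lets the resolvent iteration pass to the limit.\<close>

lemma sam_op_tendsto:
  assumes "\<And>n. (\<lambda>K. X K n) \<longlonglongrightarrow> x n"
  shows "(\<lambda>K. sam_op p (X K) n) \<longlonglongrightarrow> sam_op p x n"
  using assms
proof (induction n arbitrary: X x rule: nat_binary_induct)
  case (even k)
  show ?case by (simp only: sam_op_even) (intro tendsto_intros even)
next
  case (odd k)
  show ?case by (simp only: sam_op_odd) (intro tendsto_intros odd)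
qed

text \<open>Every step of the recursion is a convex combination with weights 1 - p and p, which
  makes S a contraction for the sup norm.\<close>

lemma sam_op_bound:
  assumes "0 \<le> p" "p \<le> 1" "\<And>n. cmod (v n) \<le> B"
  shows "cmod (sam_op p v n) \<le> B"
  using assms(3)
proof (induction n arbitrary: v rule: nat_binary_induct)
  have combine: "cmod ((1 - of_real p) * x + of_real p * y) \<le> B" if "cmod x \<le> B" "cmod y \<le> B" for x y
  proof -
    have "cmod ((1 - of_real p) * x + of_real p * y) \<le> cmod (of_real (1 - p) * x) + cmod (of_real p * y)"
      by (metis norm_triangle_ineq of_real_1 of_real_diff)
    also have "\<dots> = (1 - p) * cmod x + p * cmod y"
      using assms by (simp add: norm_mult del: of_real_diff)
    also have "\<dots> \<le> (1 - p) * B + p * B"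
      using assms that by (intro add_mono mult_left_mono) auto
    finally show ?thesis by (simp add: algebra_simps)
  qed
  {
    case (even k)
    show ?case unfolding sam_op_even by (intro combine even)
  next
    case (odd k)
    show ?case unfolding sam_op_odd by (intro combine odd)
  }
qed

section \<open>The quadratic map and formal eigenvectors\<close>

text \<open>On an eigenvector for \<mu>, every odd entry is this multiple of the even entry before
  it; its square is the quadratic map.\<close>

definition sam_ratio :: "real \<Rightarrow> complex \<Rightarrow> complex" where
  "sam_ratio p \<mu> = (\<mu> - (1 - of_real p)) / of_real p"

lemma sam_ratio_eq: "p \<noteq> 0 \<Longrightarrow> of_real p * sam_ratio p \<mu> = \<mu> - (1 - of_real p)"
  by (simp add: sam_ratio_def)

lemma sam_map_eq: "sam_map p \<mu> = sam_ratio p \<mu> * sam_ratio p \<mu>"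
  by (simp add: sam_map_def sam_ratio_def power2_eq_square)

text \<open>Since |\<mu>| - (1 - p) \<ge> p + \<delta> \<ge> p (1 + \<delta>), the ratio has modulus
  at least 1 + \<delta>; squaring it at least doubles the excess.\<close>

lemma cmod_sam_map_ge:
  assumes p: "0 < p" "p < 1" and \<delta>: "0 \<le> \<delta>" "1 + \<delta> \<le> cmod \<mu>"
  shows "1 + 2 * \<delta> \<le> cmod (sam_map p \<mu>)"
proof -
  have "cmod \<mu> - (1 - p) \<le> cmod (\<mu> - of_real (1 - p))"
    using norm_triangle_ineq2[of \<mu> "of_real (1 - p)"] p by (simp del: of_real_diff)
  then have "p * (1 + \<delta>) \<le> cmod (\<mu> - of_real (1 - p))"
    using p \<delta> mult_right_mono[of p 1 \<delta>] by (simp add: algebra_simps)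
  then have z: "1 + \<delta> \<le> cmod (sam_ratio p \<mu>)"
    using p by (simp add: sam_ratio_def norm_divide pos_le_divide_eq mult.commute)
  have "1 + 2 * \<delta> \<le> (1 + \<delta>) * (1 + \<delta>)"
    by (simp add: algebra_simps)
  also have "\<dots> \<le> cmod (sam_ratio p \<mu>) * cmod (sam_ratio p \<mu>)"
    using z \<delta> by (intro mult_mono) auto
  finally show ?thesis
    by (simp add: sam_map_eq norm_mult)
qed

text \<open>Once an orbit leaves the closed unit disc, its excess over 1 at least doubles at every
  step, so a bound by any constant forces the bound 1.\<close>

lemma filled_julia_sam_map_iff:
  assumes p: "0 < p" "p < 1"
  shows "\<mu> \<in> filled_julia (sam_map p) \<longleftrightarrow> (\<forall>i. cmod ((sam_map p ^^ i) \<mu>) \<le> 1)"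
proof
  assume "\<forall>i. cmod ((sam_map p ^^ i) \<mu>) \<le> 1"
  then show "\<mu> \<in> filled_julia (sam_map p)"
    unfolding filled_julia_def bounded_iff by auto
next
  assume "\<mu> \<in> filled_julia (sam_map p)"
  then obtain B where B: "\<And>i. cmod ((sam_map p ^^ i) \<mu>) \<le> B"
    unfolding filled_julia_def bounded_iff by auto
  show "\<forall>i. cmod ((sam_map p ^^ i) \<mu>) \<le> 1"
  proof (rule ccontr)
    assume "\<not> (\<forall>i. cmod ((sam_map p ^^ i) \<mu>) \<le> 1)"
    then obtain i where i: "cmod ((sam_map p ^^ i) \<mu>) > 1" by (auto simp: not_le)
    define \<delta> where "\<delta> = cmod ((sam_map p ^^ i) \<mu>) - 1"
    have growth: "1 + 2 ^ k * \<delta> \<le> cmod ((sam_map p ^^ (k + i)) \<mu>)" for k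
    proof (induction k)
      case (Suc k)
      have "1 + 2 * (2 ^ k * \<delta>) \<le> cmod (sam_map p ((sam_map p ^^ (k + i)) \<mu>))"
        by (rule cmod_sam_map_ge[OF p _ Suc]) (use i in \<open>simp add: \<delta>_def\<close>)
      then show ?case by (simp add: mult.assoc)
    qed (simp add: \<delta>_def)
    obtain k where "B / \<delta> < 2 ^ k"
      using real_arch_pow[of 2] by auto
    then have "B < 2 ^ k * \<delta>"
      using i by (simp add: \<delta>_def pos_divide_less_eq)
    with growth[of k] B[of "k + i"] show False by linarith
  qed
qed

lemma sam_map_in_filled_julia:
  assumes "0 < p" "p < 1" "\<mu> \<in> filled_julia (sam_map p)"
  shows "sam_map p \<mu> \<in> filled_julia (sam_map p)"
  using assms by (auto simp: filled_julia_sam_map_iff funpow_swap1 dest: spec[of _ "Suc _"])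

text \<open>The square of the ratio is the first iterate, which lies in the unit disc.\<close>

lemma cmod_sam_ratio_le:
  assumes p: "0 < p" "p < 1" and "\<mu> \<in> filled_julia (sam_map p)"
  shows "cmod (sam_ratio p \<mu>) \<le> 1"
proof -
  have "cmod ((sam_map p ^^ 1) \<mu>) \<le> 1"
    using assms filled_julia_sam_map_iff[OF p] by blast
  then have "(cmod (sam_ratio p \<mu>))\<^sup>2 \<le> 1\<^sup>2"
    by (simp add: sam_map_eq norm_mult power2_eq_square)
  then show ?thesis
    by (rule power2_le_imp_le) simp
qed

lemma one_in_filled_julia: "0 < p \<Longrightarrow> p < 1 \<Longrightarrow> 1 \<in> filled_julia (sam_map p)"
proof -
  assume p: "0 < p" "p < 1"
  have "sam_map p 1 = 1" using p by (simp add: sam_map_def)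
  then have "(sam_map p ^^ i) 1 = 1" for i by (induction i) auto
  then show ?thesis by (simp add: filled_julia_sam_map_iff[OF p])
qed

section \<open>Reduction from \<mu> to f(\<mu>), and formal eigenvectors\<close>

definition interleave :: "(nat \<Rightarrow> 'a) \<Rightarrow> (nat \<Rightarrow> 'a) \<Rightarrow> nat \<Rightarrow> 'a" where
  "interleave a b n = (if even n then a (n div 2) else b (n div 2))"

lemma interleave_simps [simp]:
  "interleave a b (2 * k) = a k" "interleave a b (2 * k + 1) = b k" "interleave a b (Suc (2 * k)) = b k"
  by (auto simp: interleave_def)

text \<open>The odd part of \<open>v\<close> is chosen so that the even rows hold exactly.
  Substituting it into the odd rows leaves the equation for f(\<mu>) on \<open>a\<close>, so a
  solution there with right side (w_odd + z w_even) / p lifts to \<mu>.\<close>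

lemma sam_op_interleave:
  fixes p :: real and \<mu> :: complex and a w :: "nat \<Rightarrow> complex"
  assumes "p \<noteq> 0"
  defines "z \<equiv> sam_ratio p \<mu>"
  defines "v \<equiv> interleave a (\<lambda>k. z * a k + w (2 * k) / of_real p)"
  shows "sam_op p v (2 * k) - \<mu> * v (2 * k) = w (2 * k)"
    and "sam_op p v (2 * k + 1) - \<mu> * v (2 * k + 1) =
           of_real p * (sam_op p a k - sam_map p \<mu> * a k) - z * w (2 * k)"
proof -
  let ?p = "complex_of_real p"
  have pz: "?p * z = \<mu> - (1 - ?p)" using assms(1) by (simp add: z_def sam_ratio_eq)
  have pw: "?p * (w (2 * k) / ?p) = w (2 * k)" using assms(1) by simp
  \<comment> \<open>The odd rows as a ring identity: \<open>q\<close>, \<open>y\<close>,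
    \<open>m\<close> stand for p, z, \<mu>, and \<open>x\<close>, \<open>s\<close> for the entries
    of \<open>a\<close> and S \<open>a\<close> at k. Eliminating \<open>m\<close> and
    \<open>t\<close> leaves only normalisation.\<close>
  have identity: "(1 - q) * (y * x + u) + q * s - m * (y * x + u) = q * (s - y * y * x) - y * t"
    if "q * y = m - (1 - q)" "q * u = t" for q y x u s m t :: complex
  proof -
    have m: "m = q * y + (1 - q)" using that(1) by (simp add: algebra_simps)
    show ?thesis unfolding m that(2)[symmetric] by (simp add: algebra_simps)
  qed
  show "sam_op p v (2 * k) - \<mu> * v (2 * k) = w (2 * k)"
    unfolding sam_op_even v_def interleave_simps using pz pw by algebra
  have ev: "(\<lambda>j. v (2 * j)) = a" by (simp add: v_def)
  show "sam_op p v (2 * k + 1) - \<mu> * v (2 * k + 1) =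
           of_real p * (sam_op p a k - sam_map p \<mu> * a k) - z * w (2 * k)"
    unfolding sam_op_odd ev sam_map_eq z_def[symmetric] unfolding v_def interleave_simps
    by (rule identity[OF pz pw])
qed

text \<open>Digits are read from the least significant one; the parameter moves one step along the
  orbit of f at each halving, so digit i contributes the ratio at the i-th iterate.\<close>

fun sam_eigvec :: "real \<Rightarrow> complex \<Rightarrow> nat \<Rightarrow> complex" where
  "sam_eigvec p \<mu> n =
     (if n = 0 then 1
      else (if even n then 1 else sam_ratio p \<mu>) * sam_eigvec p (sam_map p \<mu>) (n div 2))"

declare sam_eigvec.simps [simp del]

lemma sam_eigvec_0: "sam_eigvec p \<mu> 0 = 1"
  by (simp add: sam_eigvec.simps)

lemma sam_eigvec_even: "sam_eigvec p \<mu> (2 * k) = sam_eigvec p (sam_map p \<mu>) k"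
  by (subst sam_eigvec.simps) (auto simp: sam_eigvec_0)

lemma sam_eigvec_odd:
  "sam_eigvec p \<mu> (2 * k + 1) = sam_ratio p \<mu> * sam_eigvec p (sam_map p \<mu>) k"
  by (subst sam_eigvec.simps) simp

text \<open>A power of two has a single digit 1, so these indices expose the orbit of ratios. They
  are the test positions for convergence to 0.\<close>

lemma sam_eigvec_power2: "sam_eigvec p \<mu> (2 ^ i) = sam_ratio p ((sam_map p ^^ i) \<mu>)"
proof (induction i arbitrary: \<mu>)
  case 0
  show ?case using sam_eigvec_odd[of p \<mu> 0] by (simp add: sam_eigvec_0)
next
  case (Suc i)
  then show ?case by (simp add: sam_eigvec_even funpow_swap1)
qed

text \<open>Even rows use \<mu> = (1 - p) + p z; odd rows apply the claim for f(\<mu>) = z z to the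
  even part.\<close>

lemma sam_op_eigvec:
  assumes "p \<noteq> 0"
  shows "sam_op p (sam_eigvec p \<mu>) n = \<mu> * sam_eigvec p \<mu> n"
proof (induction n arbitrary: \<mu> rule: nat_binary_induct)
  case (even k)
  show ?case
    unfolding sam_op_even sam_eigvec_even sam_eigvec_odd
    using sam_ratio_eq[OF assms, of \<mu>] by algebra
next
  case (odd k)
  show ?case
    unfolding sam_op_odd sam_eigvec_even sam_eigvec_odd odd sam_map_eq
    using sam_ratio_eq[OF assms, of \<mu>] by algebra
qed

text \<open>The even rows force each odd entry to be z times its even neighbour; the odd rows then
  make the even part an eigenvector for f(\<mu>), so \<open>v 0\<close> determines
  everything.\<close>

lemma sam_op_eigvec_unique:
  assumes "p \<noteq> 0" and "\<And>n. sam_op p v n = \<mu> * v n"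
  shows "v n = v 0 * sam_eigvec p \<mu> n"
  using assms(2)
proof (induction n arbitrary: v \<mu> rule: less_induct)
  case (less n)
  let ?z = "sam_ratio p \<mu>" and ?p = "complex_of_real p"
  have pz: "?p * ?z = \<mu> - (1 - ?p)" using assms(1) by (simp add: sam_ratio_eq)
  have step: "v (2 * k + 1) = ?z * v (2 * k)" for k
  proof -
    have "?p * v (2 * k + 1) = ?p * (?z * v (2 * k))"
      using less.prems[of "2 * k"] pz unfolding sam_op_even by algebra
    then show ?thesis using assms(1) by simp
  qed
  have "?p * sam_op p (\<lambda>j. v (2 * j)) k = ?p * (sam_map p \<mu> * v (2 * k))" for k
    using less.prems[of "2 * k + 1"] pz unfolding sam_op_odd step sam_map_eq by algebra
  then have "sam_op p (\<lambda>j. v (2 * j)) k = sam_map p \<mu> * v (2 * k)" for k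
    using assms(1) by simp
  then have IH: "v (2 * k) = v 0 * sam_eigvec p (sam_map p \<mu>) k" if "k < n" for k
    using less.IH[OF that, of "\<lambda>j. v (2 * j)" "sam_map p \<mu>"] by simp
  show ?case
  proof (cases "n = 0")
    case False
    show ?thesis
    proof (cases "even n")
      case True
      then obtain k where "n = 2 * k" by blast
      with IH[of k] False show ?thesis by (simp add: sam_eigvec_even)
    next
      case odd: False
      then obtain k where "n = 2 * k + 1" using oddE by blast
      with IH[of k] show ?thesis by (simp add: step[simplified] sam_eigvec_odd[simplified])
    qed
  qed (simp add: sam_eigvec_0)
qed

text \<open>Successive ratios satisfy z' = (z z - (1 - p)) / p. A limit 0 would have to be fixed by
  this map, which forces p = 1.\<close>

lemma sam_ratio_orbit_not_null:
  assumes "p \<noteq> 0" "p \<noteq> 1"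
  shows "\<not> (\<lambda>i. sam_ratio p ((sam_map p ^^ i) \<mu>)) \<longlonglongrightarrow> 0"
proof
  let ?z = "\<lambda>i. sam_ratio p ((sam_map p ^^ i) \<mu>)"
  assume lim: "?z \<longlonglongrightarrow> 0"
  have "(\<lambda>i. (?z i * ?z i - (1 - of_real p)) / of_real p) \<longlonglongrightarrow> (0 * 0 - (1 - of_real p)) / of_real p"
    using assms by (intro tendsto_intros lim) auto
  moreover have "?z (Suc i) = (?z i * ?z i - (1 - of_real p)) / of_real p" for i
    unfolding funpow.simps o_apply sam_map_eq[symmetric] by (simp add: sam_ratio_def)
  ultimately have "(\<lambda>i. ?z (Suc i)) \<longlonglongrightarrow> - (1 - of_real p) / of_real p"
    by simp
  then have "- (1 - complex_of_real p) / of_real p = 0"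
    using LIMSEQ_unique LIMSEQ_Suc[OF lim] by blast
  then have "1 - complex_of_real p = 0" using assms by simp
  then have "complex_of_real p = of_real 1" by simp
  then show False using assms(2) by (simp only: of_real_eq_iff)
qed

text \<open>By uniqueness \<open>v\<close> is a multiple of the formal eigenvector, whose entries at
  powers of two do not tend to 0. This gives injectivity on all spaces of null sequences at
  once.\<close>

lemma sam_op_null_eigenvector:
  assumes "p \<noteq> 0" "p \<noteq> 1" and "v \<longlonglongrightarrow> 0" and "\<And>n. sam_op p v n = \<mu> * v n"
  shows "v = (\<lambda>n. 0)"
proof -
  have v: "v n = v 0 * sam_eigvec p \<mu> n" for n
    by (rule sam_op_eigvec_unique) (use assms in auto)
  have "v 0 = 0"
  proof (rule ccontr)
    assume "v 0 \<noteq> 0"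
    have "strict_mono (\<lambda>i. 2 ^ i :: nat)" by (rule strict_monoI) simp
    then have "(\<lambda>i. v (2 ^ i)) \<longlonglongrightarrow> 0"
      using LIMSEQ_subseq_LIMSEQ[OF assms(3)] by (simp add: o_def)
    then have "(\<lambda>i. inverse (v 0) * v (2 ^ i)) \<longlonglongrightarrow> 0"
      using tendsto_mult_left[of _ 0] by fastforce
    moreover have "inverse (v 0) * v (2 ^ i) = sam_ratio p ((sam_map p ^^ i) \<mu>)" for i
      using v[of "2 ^ i"] \<open>v 0 \<noteq> 0\<close> by (simp add: sam_eigvec_power2)
    ultimately show False
      using sam_ratio_orbit_not_null[OF assms(1,2)] by simp
  qed
  with v show ?thesis by auto
qed

section \<open>Norm estimates and the range on formal sequences\<close>

lemma sum_even_odd: "(\<Sum>n<2 * M. f n) = (\<Sum>k<M. f (2 * k)) + (\<Sum>k<M. f (2 * k + 1))"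
  for f :: "nat \<Rightarrow> 'a::comm_monoid_add"
  by (induction M) (simp_all add: algebra_simps)

lemma powr_convex_combination:
  fixes x y :: real
  assumes "1 \<le> \<alpha>" "0 \<le> x" "0 \<le> y" "0 \<le> t" "t \<le> 1"
  shows "((1 - t) * x + t * y) powr \<alpha> \<le> (1 - t) * x powr \<alpha> + t * y powr \<alpha>"
proof (cases "x = 0 \<or> y = 0")
  case True
  \<comment> \<open>With one argument 0 the claim reduces to \<open>s powr \<alpha> \<le> s\<close>
    for s in [0, 1]; the other case is convexity of the power at positive arguments.\<close>
  have scale: "(s * u) powr \<alpha> \<le> s * u powr \<alpha>" if "0 \<le> s" "s \<le> 1" "0 \<le> u" for s u :: real
  proof -
    have "s powr \<alpha> \<le> s powr 1" if "0 < s"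
      using that \<open>s \<le> 1\<close> assms(1) by (intro powr_mono') auto
    then have "s powr \<alpha> \<le> s" using \<open>0 \<le> s\<close> by (cases "s = 0") auto
    then show ?thesis using that by (simp add: powr_mult mult_right_mono)
  qed
  from True show ?thesis
    using scale[of "1 - t" x] scale[of t y] assms by auto
next
  case False
  then show ?thesis
    using convex_onD[OF powr_convex[OF assms(1)], of t x y] assms by simp
qed

text \<open>Normalise the weights to sum 1 and extract s + t by homogeneity. Applied entrywise, it
  replaces the Minkowski inequality for two vectors in a common ball.\<close>

lemma powr_subconvex_combination:
  fixes x y :: real
  assumes "1 \<le> \<alpha>" "0 \<le> x" "0 \<le> y" "0 \<le> s" "0 \<le> t"
  shows "(s * x + t * y) powr \<alpha> \<le> (s + t) powr \<alpha> * ((s / (s + t)) * x powr \<alpha> + (t / (s + t)) * y powr \<alpha>)"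
proof (cases "s + t = 0")
  case False
  let ?\<theta> = "t / (s + t)"
  have \<theta>: "0 \<le> ?\<theta>" "?\<theta> \<le> 1" and one: "1 - ?\<theta> = s / (s + t)"
    using assms False by (auto simp: field_simps)
  have "s * x + t * y = (s + t) * ((1 - ?\<theta>) * x + ?\<theta> * y)"
    unfolding one using False by (simp add: distrib_left)
  then have "(s * x + t * y) powr \<alpha> = (s + t) powr \<alpha> * ((1 - ?\<theta>) * x + ?\<theta> * y) powr \<alpha>"
    using assms \<theta> by (simp add: powr_mult)
  also have "\<dots> \<le> (s + t) powr \<alpha> * ((1 - ?\<theta>) * x powr \<alpha> + ?\<theta> * y powr \<alpha>)"
    by (intro mult_left_mono powr_convex_combination) (use assms \<theta> in auto)
  finally show ?thesis unfolding one .
qed (use assms in \<open>simp add: add_nonneg_eq_0_iff\<close>)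

text \<open>S on real sequences, encoded through the even-odd recursion alone so that convexity can
  be applied level by level.\<close>

function sam_avg :: "real \<Rightarrow> (nat \<Rightarrow> real) \<Rightarrow> nat \<Rightarrow> real" where
  "sam_avg p a n =
     (1 - p) * a n + p * (if even n then a (n + 1) else sam_avg p (\<lambda>j. a (2 * j)) (n div 2))"
  by auto
termination
  by (relation "Wellfounded.measure (\<lambda>(p, a, n). n)") (auto elim: oddE)

declare sam_avg.simps [simp del]

lemma sam_avg_even: "sam_avg p a (2 * k) = (1 - p) * a (2 * k) + p * a (2 * k + 1)"
  by (subst sam_avg.simps) simp

lemma sam_avg_odd:
  "sam_avg p a (2 * k + 1) = (1 - p) * a (2 * k + 1) + p * sam_avg p (\<lambda>j. a (2 * j)) k"
  by (subst sam_avg.simps) simp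

text \<open>Jensen's inequality for the rows, which are probability vectors, carried out one
  two-term combination at a time.\<close>

lemma sam_op_powr_le_avg:
  assumes p: "0 \<le> p" "p \<le> 1" and "1 \<le> \<alpha>"
  shows "cmod (sam_op p v n) powr \<alpha> \<le> sam_avg p (\<lambda>j. cmod (v j) powr \<alpha>) n"
proof (induction n arbitrary: v rule: nat_binary_induct)
  have combine: "cmod ((1 - of_real p) * x + of_real p * y) powr \<alpha> \<le> (1 - p) * cmod x powr \<alpha> + p * c"
    if "cmod y powr \<alpha> \<le> c" for x y c
  proof -
    have "cmod ((1 - of_real p) * x + of_real p * y) \<le> cmod (of_real (1 - p) * x) + cmod (of_real p * y)"
      by (metis norm_triangle_ineq of_real_1 of_real_diff)
    also have "\<dots> = (1 - p) * cmod x + p * cmod y"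
      using p by (simp add: norm_mult del: of_real_diff)
    finally have "cmod ((1 - of_real p) * x + of_real p * y) powr \<alpha> \<le> ((1 - p) * cmod x + p * cmod y) powr \<alpha>"
      using assms by (intro powr_mono2) auto
    also have "\<dots> \<le> (1 - p) * cmod x powr \<alpha> + p * cmod y powr \<alpha>"
      by (rule powr_convex_combination) (use assms in auto)
    also have "\<dots> \<le> (1 - p) * cmod x powr \<alpha> + p * c"
      using p that by (simp add: mult_left_mono)
    finally show ?thesis .
  qed
  {
    case (even k)
    show ?case unfolding sam_op_even sam_avg_even by (rule combine) simp
  next
    case (odd k)
    show ?case unfolding sam_op_odd sam_avg_odd by (intro combine odd)
  }
qed

text \<open>Column sums are at most 1: odd entries collect p + (1 - p), even ones 1 - p directly and
  p through the induction. The right side includes the index 2^N because row 2^N - 1 reaches that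
  column.\<close>

lemma sum_sam_avg_le:
  assumes p: "0 \<le> p" "p \<le> 1" and "\<And>n. 0 \<le> a n"
  shows "(\<Sum>n<2 ^ N. sam_avg p a n) \<le> (\<Sum>n\<le>2 ^ N. a n)"
  using assms(3)
proof (induction N arbitrary: a)
  case 0
  have "(1 - p) * a 0 + p * a 1 \<le> 1 * a 0 + 1 * a 1"
    using 0 p by (intro add_mono mult_right_mono) auto
  then show ?case using sam_avg_even[of p a 0] by simp
next
  case (Suc N)
  let ?M = "2 ^ N :: nat"
  let ?e = "\<Sum>k<?M. a (2 * k)" and ?o = "\<Sum>k<?M. a (2 * k + 1)"
  have "(\<Sum>n<2 ^ Suc N. sam_avg p a n) =
      (1 - p) * ?e + p * ?o + ((1 - p) * ?o + p * (\<Sum>k<?M. sam_avg p (\<lambda>j. a (2 * j)) k))"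
    unfolding power_Suc sum_even_odd sam_avg_even sam_avg_odd by (simp add: sum.distrib sum_distrib_left)
  also have "\<dots> \<le> (1 - p) * ?e + p * ?o + ((1 - p) * ?o + p * (\<Sum>k\<le>?M. a (2 * k)))"
    using Suc.IH[of "\<lambda>j. a (2 * j)"] Suc.prems p by (intro add_left_mono mult_left_mono) auto
  also have "\<dots> = ?e + ?o + p * a (2 * ?M)"
    by (simp add: lessThan_Suc_atMost[symmetric] algebra_simps)
  also have "\<dots> \<le> ?e + ?o + 1 * a (2 * ?M)"
    using Suc.prems p by (intro add_left_mono mult_right_mono) auto
  also have "\<dots> = (\<Sum>n\<le>2 ^ Suc N. a n)"
    unfolding power_Suc lessThan_Suc_atMost[symmetric] sum.lessThan_Suc sum_even_odd by simp
  finally show ?case .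
qed

lemma sum_sam_op_powr_le:
  assumes p: "0 \<le> p" "p \<le> 1" and "1 \<le> \<alpha>"
  shows "(\<Sum>n<2 ^ N. cmod (sam_op p v n) powr \<alpha>) \<le> (\<Sum>n\<le>2 ^ N. cmod (v n) powr \<alpha>)"
  by (rule order_trans[OF sum_mono sum_sam_avg_le[OF p]]) (simp_all add: sam_op_powr_le_avg assms)

lemma sum_sam_op_le:
  assumes "0 \<le> p" "p \<le> 1"
  shows "(\<Sum>n<2 ^ N. cmod (sam_op p v n)) \<le> (\<Sum>n\<le>2 ^ N. cmod (v n))"
  using sum_sam_op_powr_le[OF assms, of 1 v N] by simp

section \<open>A summable sequence outside the range\<close>

fun bit_length :: "nat \<Rightarrow> nat" where
  "bit_length n = (if n = 0 then 0 else Suc (bit_length (n div 2)))"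

declare bit_length.simps [simp del]

lemma bit_length_simps [simp]:
  "bit_length 0 = 0"
  "bit_length (2 * k) = (if k = 0 then 0 else Suc (bit_length k))"
  "bit_length (Suc (2 * k)) = Suc (bit_length k)"
  by (simp_all add: bit_length.simps[of 0] bit_length.simps[of "2 * k"] bit_length.simps[of "Suc (2 * k)"])

lemma bit_length_power2: "bit_length (2 ^ i) = Suc i"
proof (induction i)
  case 0
  show ?case using bit_length_simps(3)[of 0] by simp
qed simp

text \<open>Halving lowers \<open>bit_length\<close> by one except at 0, so this weight preserves
  the eigenvector recursion up to a correction at index 0. The weight is unbounded, yet the defect
  stays summable.\<close>

definition sam_geneigvec :: "real \<Rightarrow> complex \<Rightarrow> nat \<Rightarrow> complex" where
  "sam_geneigvec p \<mu> n = sam_eigvec p \<mu> n * of_nat (bit_length n)"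

definition sam_defect :: "real \<Rightarrow> complex \<Rightarrow> nat \<Rightarrow> complex" where
  "sam_defect p \<mu> n = sam_op p (sam_geneigvec p \<mu>) n - \<mu> * sam_geneigvec p \<mu> n"

text \<open>The eigenvector terms cancel, leaving the difference of the bit lengths of 2k + 1 and
  2k. They agree unless k = 0.\<close>

lemma sam_defect_even:
  assumes "p \<noteq> 0"
  shows "sam_defect p \<mu> (2 * k) = (if k = 0 then of_real p * sam_ratio p \<mu> else 0)"
proof -
  let ?p = "complex_of_real p" and ?z = "sam_ratio p \<mu>"
  have pz: "\<mu> = ?p * ?z + (1 - ?p)" using assms by (simp add: sam_ratio_eq)
  have "sam_defect p \<mu> (2 * k) = ?p * ?z * sam_eigvec p (sam_map p \<mu>) k *
      (of_nat (bit_length (2 * k + 1)) - of_nat (bit_length (2 * k)))"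
    unfolding sam_defect_def sam_op_even sam_geneigvec_def sam_eigvec_even sam_eigvec_odd
    by (subst (4) pz) (simp add: algebra_simps)
  then show ?thesis by (simp add: sam_eigvec_0)
qed

text \<open>The even part of u at \<mu> is u + v at f(\<mu>) minus the unit vector at 0, since
  doubling lengthens every index but 0. The multiples of v cancel.\<close>

lemma sam_defect_odd:
  assumes "p \<noteq> 0"
  shows "sam_defect p \<mu> (2 * k + 1) =
    of_real p * (sam_defect p (sam_map p \<mu>) k - sam_op p (\<lambda>n. if n = 0 then 1 else 0) k)"
proof -
  let ?p = "complex_of_real p" and ?z = "sam_ratio p \<mu>" and ?f = "sam_map p \<mu>"
  let ?u = "sam_geneigvec p ?f" and ?v = "sam_eigvec p ?f"
  define \<delta> :: "nat \<Rightarrow> complex" where "\<delta> = (\<lambda>n. if n = 0 then 1 else 0)"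
  have pz: "?p * ?z = \<mu> - (1 - ?p)" using assms by (simp add: sam_ratio_eq)
  have "(\<lambda>j. sam_geneigvec p \<mu> (2 * j)) = (\<lambda>j. 1 * (1 * ?u j + 1 * ?v j) + (-1) * \<delta> j)"
    by (intro ext) (simp add: sam_geneigvec_def sam_eigvec_even \<delta>_def sam_eigvec_0 distrib_left)
  then have S: "sam_op p (\<lambda>j. sam_geneigvec p \<mu> (2 * j)) k = sam_op p ?u k + ?f * ?v k - sam_op p \<delta> k"
    by (simp only: sam_op_lincomb sam_op_eigvec[OF assms]) simp
  have odd: "sam_geneigvec p \<mu> (2 * k + 1) = ?z * (?u k + ?v k)"
    unfolding sam_geneigvec_def sam_eigvec_odd by (simp add: distrib_left)
  have "sam_defect p \<mu> (2 * k + 1) =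
      (1 - ?p - \<mu>) * (?z * (?u k + ?v k)) + ?p * (sam_op p ?u k + ?f * ?v k - sam_op p \<delta> k)"
    unfolding sam_defect_def sam_op_odd S odd by (simp add: algebra_simps)
  also have "1 - ?p - \<mu> = - (?p * ?z)"
    unfolding pz by simp
  also have "- (?p * ?z) * (?z * (?u k + ?v k)) + ?p * (sam_op p ?u k + ?f * ?v k - sam_op p \<delta> k) =
      ?p * (sam_defect p ?f k - sam_op p \<delta> k)"
    unfolding sam_defect_def by (simp add: sam_map_eq algebra_simps)
  finally show ?thesis unfolding \<delta>_def .
qed

text \<open>The bound solves B = p + p (B + 1): the first p comes from row 0, B from the defect at
  f(\<mu>), and 1 from the \<open>\<ell>\<^sup>1\<close> norm of S applied to a unit vector.\<close>

lemma sum_sam_defect_power2_le: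
  assumes p: "0 < p" "p < 1" and "\<mu> \<in> filled_julia (sam_map p)"
  shows "(\<Sum>n<2 ^ N. cmod (sam_defect p \<mu> n)) \<le> 2 * p / (1 - p)"
  using assms(3)
proof (induction N arbitrary: \<mu>)
  case 0
  have "cmod (sam_defect p \<mu> 0) \<le> p * 1"
    using sam_defect_even[of p \<mu> 0] cmod_sam_ratio_le[OF p 0] p
    by (simp add: norm_mult)
  also have "p * 1 \<le> 2 * p / (1 - p)" using p by (simp add: field_simps)
  finally show ?case by simp
next
  case (Suc N)
  let ?M = "2 ^ N :: nat" and ?B = "2 * p / (1 - p)" and ?f = "sam_map p \<mu>"
  define \<delta> :: "nat \<Rightarrow> complex" where "\<delta> = (\<lambda>n. if n = 0 then 1 else 0)"
  have "(\<Sum>n<2 ^ Suc N. cmod (sam_defect p \<mu> n)) =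
      p * cmod (sam_ratio p \<mu>) + p * (\<Sum>k<?M. cmod (sam_defect p ?f k - sam_op p \<delta> k))"
  proof -
    have "(\<Sum>k<?M. cmod (sam_defect p \<mu> (2 * k))) = (\<Sum>k<?M. if k = 0 then p * cmod (sam_ratio p \<mu>) else 0)"
      using p by (intro sum.cong) (auto simp: sam_defect_even norm_mult)
    moreover have "(\<Sum>k<?M. cmod (sam_defect p \<mu> (2 * k + 1))) =
        p * (\<Sum>k<?M. cmod (sam_defect p ?f k - sam_op p \<delta> k))"
      using p by (subst sam_defect_odd) (simp_all add: norm_mult sum_distrib_left \<delta>_def)
    ultimately show ?thesis unfolding power_Suc sum_even_odd by simp
  qed
  also have "\<dots> \<le> p * 1 + p * (?B + 1)"
  proof (intro add_mono mult_left_mono cmod_sam_ratio_le p Suc.prems)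
    have "(\<Sum>k<?M. cmod (sam_op p \<delta> k)) \<le> (\<Sum>n\<le>?M. cmod (\<delta> n))"
      using p by (intro sum_sam_op_le) auto
    also have "\<dots> = (\<Sum>n\<le>?M. if n = 0 then 1 else 0)"
      by (intro sum.cong) (auto simp: \<delta>_def)
    finally have "(\<Sum>k<?M. cmod (sam_op p \<delta> k)) \<le> 1" by simp
    moreover have "(\<Sum>k<?M. cmod (sam_defect p ?f k)) \<le> ?B"
      by (rule Suc.IH[OF sam_map_in_filled_julia[OF p Suc.prems]])
    moreover have "(\<Sum>k<?M. cmod (sam_defect p ?f k - sam_op p \<delta> k))
        \<le> (\<Sum>k<?M. cmod (sam_defect p ?f k) + cmod (sam_op p \<delta> k))"
      by (intro sum_mono norm_triangle_ineq4)
    ultimately show "(\<Sum>k<?M. cmod (sam_defect p ?f k - sam_op p \<delta> k)) \<le> ?B + 1"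
      by (simp add: sum.distrib)
  qed (use p in auto)
  also have "\<dots> = ?B" using p by (simp add: field_simps)
  finally show ?case .
qed

lemma sum_sam_defect_le:
  assumes "0 < p" "p < 1" and "\<mu> \<in> filled_julia (sam_map p)"
  shows "(\<Sum>n<N. cmod (sam_defect p \<mu> n)) \<le> 2 * p / (1 - p)"
proof -
  have "(\<Sum>n<N. cmod (sam_defect p \<mu> n)) \<le> (\<Sum>n<2 ^ N. cmod (sam_defect p \<mu> n))"
    using less_exp[of N] by (intro sum_mono2) auto
  also note sum_sam_defect_power2_le[OF assms]
  finally show ?thesis .
qed

text \<open>A preimage \<open>v\<close> would differ from u by a multiple of the formal eigenvector.
  Its entry at 2^i is then the i-th ratio times a factor tending to infinity, so \<open>v\<close>
  null would make the ratios null.\<close>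

lemma sam_defect_not_in_range:
  assumes "p \<noteq> 0" "p \<noteq> 1" and "v \<longlonglongrightarrow> 0"
  shows "\<exists>n. sam_op p v n - \<mu> * v n \<noteq> sam_defect p \<mu> n"
proof (rule ccontr)
  assume "\<nexists>n. sam_op p v n - \<mu> * v n \<noteq> sam_defect p \<mu> n"
  then have eq: "sam_op p v n - \<mu> * v n = sam_op p (sam_geneigvec p \<mu>) n - \<mu> * sam_geneigvec p \<mu> n" for n
    by (simp add: sam_defect_def)
  define d where "d = (\<lambda>n. 1 * v n + (-1) * sam_geneigvec p \<mu> n)"
  have "sam_op p d n = \<mu> * d n" for n
    using eq[of n] unfolding d_def sam_op_lincomb by (simp add: algebra_simps)
  then have d: "d n = d 0 * sam_eigvec p \<mu> n" for n
    using sam_op_eigvec_unique[OF assms(1)] by blast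
  \<comment> \<open>The bit length of 2^i is i + 1, and \<open>d 0\<close> is the coefficient of the
    eigenvector in \<open>d\<close>.\<close>
  define t where "t = (\<lambda>i. of_nat (Suc i) + d 0)"
  have v: "v (2 ^ i) = sam_ratio p ((sam_map p ^^ i) \<mu>) * t i" for i
    using d[of "2 ^ i"]
    by (simp add: d_def t_def sam_geneigvec_def sam_eigvec_power2 bit_length_power2 algebra_simps)
  have "strict_mono (\<lambda>i. 2 ^ i :: nat)" by (rule strict_monoI) simp
  then have "(\<lambda>i. v (2 ^ i)) \<longlonglongrightarrow> 0"
    using LIMSEQ_subseq_LIMSEQ[OF assms(3)] by (simp add: o_def)
  moreover have t: "filterlim t at_infinity sequentially"
    unfolding t_def
    by (rule tendsto_add_filterlim_at_infinity'
          [OF filterlim_compose[OF tendsto_of_nat filterlim_Suc] tendsto_const])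
  ultimately have "(\<lambda>i. v (2 ^ i) * inverse (t i)) \<longlonglongrightarrow> 0 * 0"
    by (intro tendsto_mult tendsto_inverse_0[THEN filterlim_compose])
  moreover have "\<forall>\<^sub>F i in sequentially. t i \<noteq> 0"
    using t by (rule filterlim_at_infinity_imp_eventually_ne)
  then have "\<forall>\<^sub>F i in sequentially. v (2 ^ i) * inverse (t i) = sam_ratio p ((sam_map p ^^ i) \<mu>)"
    by eventually_elim (simp add: v)
  ultimately have "(\<lambda>i. sam_ratio p ((sam_map p ^^ i) \<mu>)) \<longlonglongrightarrow> 0"
    using tendsto_cong by force
  then show False using sam_ratio_orbit_not_null[OF assms(1,2)] by blast
qed

section \<open>Unit vectors modulo the range\<close>

lemma sam_op_zero [simp]: "sam_op p (\<lambda>n. 0) n = 0"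
  by (rule sam_op_const)

text \<open>Halving the support passes from \<open>w\<close> at \<mu> to w_odd + z w_even at
  f(\<mu>) until only index 0 is left. As |z| \<le> 1 the total mass does not grow, and on lifting
  back the leftover position k becomes 2k + 1, hence 2^N - 1.\<close>

lemma unit_vector_range_sam_op:
  fixes w :: "nat \<Rightarrow> complex"
  assumes p: "0 < p" "p < 1" and "\<mu> \<in> filled_julia (sam_map p)" and "\<And>n. 2 ^ N \<le> n \<Longrightarrow> w n = 0"
  shows "\<exists>c v. cmod c \<le> (\<Sum>n<2 ^ N. cmod (w n)) \<and> (\<exists>M. \<forall>n\<ge>M. v n = 0) \<and>
           (\<forall>n. sam_op p v n - \<mu> * v n = w n - c * (if n = 2 ^ N - 1 then 1 else 0))"
  using assms(3,4)
proof (induction N arbitrary: \<mu> w)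
  case 0
  show ?case
    by (intro exI[of _ "w 0"] exI[of _ "\<lambda>n. 0"]) (use 0 in auto)
next
  case (Suc N)
  let ?z = "sam_ratio p \<mu>" and ?p = "complex_of_real p"
  define w' where "w' k = w (2 * k + 1) + ?z * w (2 * k)" for k
  have "\<exists>c v. cmod c \<le> (\<Sum>n<2 ^ N. cmod (w' n)) \<and> (\<exists>M. \<forall>n\<ge>M. v n = 0) \<and>
      (\<forall>n. sam_op p v n - sam_map p \<mu> * v n = w' n - c * (if n = 2 ^ N - 1 then 1 else 0))"
    by (rule Suc.IH) (use Suc.prems in \<open>auto simp: w'_def sam_map_in_filled_julia[OF p]\<close>)
  then obtain c b M where c: "cmod c \<le> (\<Sum>n<2 ^ N. cmod (w' n))" and M: "\<And>n. M \<le> n \<Longrightarrow> b n = 0"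
    and b: "\<And>n. sam_op p b n - sam_map p \<mu> * b n = w' n - c * (if n = 2 ^ N - 1 then 1 else 0)"
    by blast
  \<comment> \<open>The factor 1 / p goes into the solution rather than the right side, so
    \<open>c\<close> is carried over without growth.\<close>
  define a where "a = (\<lambda>k. b k / ?p)"
  have a: "?p * (sam_op p a k - sam_map p \<mu> * a k) = w' k - c * (if k = 2 ^ N - 1 then 1 else 0)" for k
    using b[of k] sam_op_lincomb[of p "1 / ?p" b 0 "\<lambda>_. 0" k] p
    by (simp add: a_def algebra_simps)
  define v where "v = interleave a (\<lambda>k. ?z * a k + w (2 * k) / ?p)"
  have "sam_op p v n - \<mu> * v n = w n - c * (if n = 2 ^ Suc N - 1 then 1 else 0)" for n
  proof (cases "even n")
    case True
    then obtain k where "n = 2 * k" by blast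
    moreover have "2 * k \<noteq> 2 ^ Suc N - 1"
      using one_le_power[of "2::nat" N] unfolding power_Suc by presburger
    ultimately show ?thesis
      using sam_op_interleave(1)[where p = p and \<mu> = \<mu> and a = a and w = w and k = k] p by (simp add: v_def)
  next
    case False
    then obtain k where n: "n = 2 * k + 1" using oddE by blast
    have "2 * k + 1 = 2 ^ Suc N - 1 \<longleftrightarrow> k = 2 ^ N - 1"
      using one_le_power[of "2::nat" N] unfolding power_Suc by linarith
    then show ?thesis
      unfolding n using sam_op_interleave(2)[where p = p and \<mu> = \<mu> and a = a and w = w and k = k] a[of k] p by (simp add: v_def w'_def)
  qed
  moreover have "v n = 0" if "2 * (M + 2 ^ N) + 1 \<le> n" for n
  proof -
    have "M + 2 ^ N \<le> n div 2" using div_le_mono[of "2 * (M + 2 ^ N)" n 2] that by simp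
    then have "M \<le> n div 2" "2 ^ Suc N \<le> 2 * (n div 2)"
      unfolding power_Suc by linarith+
    then have "b (n div 2) = 0" "w (2 * (n div 2)) = 0"
      using M Suc.prems(2) by blast+
    then show ?thesis
      unfolding v_def interleave_def a_def by (simp only: div_0 mult_zero_right add_0_left if_cancel)
  qed
  moreover have "cmod c \<le> (\<Sum>n<2 ^ Suc N. cmod (w n))"
  proof -
    have "cmod (w' k) \<le> cmod (w (2 * k)) + cmod (w (2 * k + 1))" for k
    proof -
      have "cmod (w' k) \<le> cmod (w (2 * k + 1)) + cmod (?z * w (2 * k))"
        unfolding w'_def by (rule norm_triangle_ineq)
      also have "cmod (?z * w (2 * k)) \<le> 1 * cmod (w (2 * k))"
        unfolding norm_mult using cmod_sam_ratio_le[OF p Suc.prems(1)] by (intro mult_right_mono) auto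
      finally show ?thesis by simp
    qed
    then have "(\<Sum>n<2 ^ N. cmod (w' n)) \<le> (\<Sum>n<2 ^ Suc N. cmod (w n))"
      unfolding power_Suc sum_even_odd sum.distrib[symmetric] by (intro sum_mono)
    with c show ?thesis by linarith
  qed
  ultimately show ?case by blast
qed

section \<open>Spectra on spaces stable under interleaving\<close>

text \<open>Membership and a norm bound in one predicate: the axioms below become closure properties
  of balls, which in \<open>\<ell>\<^sup>\<alpha>\<close> are bounds on partial sums.\<close>

definition in_ball :: "seq_space \<Rightarrow> (nat \<Rightarrow> complex) \<Rightarrow> real \<Rightarrow> bool" where
  "in_ball E v A \<longleftrightarrow> v \<in> vecs E \<and> nrm E v \<le> A"

text \<open>A bounded choice of preimages suffices: injectivity makes the inverse linear.\<close>

lemma isomorphism_opI: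
  assumes T: "bounded_op E T" "inj_on T (vecs E)"
    and subspace: "\<And>v w a b. v \<in> vecs E \<Longrightarrow> w \<in> vecs E \<Longrightarrow> (\<lambda>n. a * v n + b * w n) \<in> vecs E"
    and inverse: "\<And>w. w \<in> vecs E \<Longrightarrow> \<exists>v\<in>vecs E. T v = w \<and> nrm E v \<le> C * nrm E w"
  shows "isomorphism_op E T"
proof -
  let ?R = "inv_into (vecs E) T"
  have R: "?R w \<in> vecs E" "T (?R w) = w" "nrm E (?R w) \<le> C * nrm E w" if "w \<in> vecs E" for w
    using inverse[OF that] T(2) by auto
  have "T ` vecs E = vecs E"
  proof
    show "T ` vecs E \<subseteq> vecs E" using T(1) unfolding bounded_op_def by blast
    show "vecs E \<subseteq> T ` vecs E" using inverse by blast
  qed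
  moreover have "?R (\<lambda>n. a * v n + b * w n) = (\<lambda>n. a * ?R v n + b * ?R w n)"
    if "v \<in> vecs E" "w \<in> vecs E" for v w a b
  proof (rule inv_into_f_eq[OF T(2)])
    show "T (\<lambda>n. a * ?R v n + b * ?R w n) = (\<lambda>n. a * v n + b * w n)"
      using T(1) R that unfolding bounded_op_def by simp
  qed (use subspace R that in auto)
  ultimately show ?thesis
    using T R unfolding isomorphism_op_def bij_betw_def bounded_op_def[of E ?R] by blast
qed

lemma isomorphism_op_image: "isomorphism_op E T \<Longrightarrow> T ` vecs E = vecs E"
  by (simp add: isomorphism_op_def bij_betw_def)

text \<open>Holds for null sequences and for \<open>\<ell>\<^sup>\<alpha>\<close> with \<alpha>
  \<ge> 1; \<open>vecs_null\<close> excludes c. The factor 2 in \<open>ball_interleave\<close>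
  serves all these norms, and \<open>ball_limit\<close> takes the place of completeness.\<close>

locale sam_space =
  fixes p :: real and E :: seq_space
  assumes p: "0 < p" "p < 1"
    and ball_lincomb: "\<And>v w a b A. in_ball E v A \<Longrightarrow> in_ball E w A \<Longrightarrow>
          in_ball E (\<lambda>n. a * v n + b * w n) ((cmod a + cmod b) * A)"
    and ball_even: "\<And>v A. in_ball E v A \<Longrightarrow> in_ball E (\<lambda>k. v (2 * k)) A"
    and ball_odd: "\<And>v A. in_ball E v A \<Longrightarrow> in_ball E (\<lambda>k. v (2 * k + 1)) A"
    and ball_interleave: "\<And>a b A. in_ball E a A \<Longrightarrow> in_ball E b A \<Longrightarrow> in_ball E (interleave a b) (2 * A)"
    and ball_sam_op: "\<And>v A. in_ball E v A \<Longrightarrow> in_ball E (sam_op p v) A"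
    and vecs_null: "\<And>v. v \<in> vecs E \<Longrightarrow> v \<longlonglongrightarrow> 0"
    and ball_sup: "\<And>v A n. in_ball E v A \<Longrightarrow> cmod (v n) \<le> A"
    and ball_ell1: "\<And>w A. (\<And>N. (\<Sum>n<N. cmod (w n)) \<le> A) \<Longrightarrow> in_ball E w A"
    and ball_limit: "\<And>X x A. (\<And>K. in_ball E (X K) A) \<Longrightarrow> uniform_limit UNIV X x sequentially \<Longrightarrow> in_ball E x A"
begin

section \<open>Boundedness, injectivity and failure of surjectivity\<close>

lemma ball_nrm: "v \<in> vecs E \<Longrightarrow> in_ball E v (nrm E v)"
  by (simp add: in_ball_def)

lemma ball_mono: "in_ball E v A \<Longrightarrow> A \<le> B \<Longrightarrow> in_ball E v B"
  by (simp add: in_ball_def)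

lemma ball_nonneg: "in_ball E v A \<Longrightarrow> 0 \<le> A"
  using ball_sup[of v A 0] norm_ge_zero order_trans by blast

lemma ball_scale: "in_ball E v A \<Longrightarrow> in_ball E (\<lambda>n. c * v n) (cmod c * A)"
  using ball_lincomb[of v A v c 0] by simp

lemma vecs_lincomb: "v \<in> vecs E \<Longrightarrow> w \<in> vecs E \<Longrightarrow> (\<lambda>n. a * v n + b * w n) \<in> vecs E"
proof -
  assume "v \<in> vecs E" "w \<in> vecs E"
  then have "in_ball E v (max (nrm E v) (nrm E w))" "in_ball E w (max (nrm E v) (nrm E w))"
    by (auto simp: in_ball_def)
  from ball_lincomb[OF this] show ?thesis by (simp add: in_ball_def)
qed

lemma vecs_finite_support:
  assumes "\<And>n. M \<le> n \<Longrightarrow> v n = 0"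
  shows "v \<in> vecs E"
proof -
  have "(\<Sum>n<N. cmod (v n)) \<le> (\<Sum>n<M. cmod (v n))" for N
  proof -
    have "(\<Sum>n<N. cmod (v n)) \<le> (\<Sum>n<max N M. cmod (v n))"
      by (rule sum_mono2) auto
    also have "\<dots> = (\<Sum>n<M. cmod (v n))"
      by (rule sum.mono_neutral_right) (auto simp: assms)
    finally show ?thesis .
  qed
  then show ?thesis using ball_ell1 in_ball_def by blast
qed

lemma ball_shift_op: "in_ball E v A \<Longrightarrow> in_ball E (shift_op (sam_op p) \<mu> v) ((1 + cmod \<mu>) * A)"
  using ball_lincomb[OF ball_sam_op, of v A v 1 "- \<mu>"] by (simp add: shift_op_def)

lemma bounded_shift_op: "bounded_op E (shift_op (sam_op p) \<mu>)"
  unfolding bounded_op_def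
proof (intro conjI ballI allI exI)
  show "shift_op (sam_op p) \<mu> ` vecs E \<subseteq> vecs E"
    using ball_shift_op[OF ball_nrm] by (auto simp: in_ball_def)
  show "shift_op (sam_op p) \<mu> (\<lambda>n. a * v n + b * w n) =
      (\<lambda>n. a * shift_op (sam_op p) \<mu> v n + b * shift_op (sam_op p) \<mu> w n)" for v w a b
    unfolding shift_op_def sam_op_lincomb by (simp add: algebra_simps)
  show "nrm E (shift_op (sam_op p) \<mu> v) \<le> (1 + cmod \<mu>) * nrm E v" if "v \<in> vecs E" for v
    using ball_shift_op[OF ball_nrm[OF that]] by (simp add: in_ball_def)
qed

lemma inj_shift_op: "inj_on (shift_op (sam_op p) \<mu>) (vecs E)"
proof (rule inj_onI)
  fix v w assume v: "v \<in> vecs E" and w: "w \<in> vecs E"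
    and eq: "shift_op (sam_op p) \<mu> v = shift_op (sam_op p) \<mu> w"
  define d where "d = (\<lambda>n. 1 * v n + (-1) * w n)"
  have "d = (\<lambda>n. 0)"
  proof (rule sam_op_null_eigenvector)
    show "d \<longlonglongrightarrow> 0" unfolding d_def by (rule vecs_null[OF vecs_lincomb[OF v w]])
    show "sam_op p d n = \<mu> * d n" for n
      using fun_cong[OF eq, of n] unfolding d_def sam_op_lincomb by (simp add: shift_op_def algebra_simps)
  qed (use p in auto)
  then show "v = w" by (simp add: d_def fun_eq_iff)
qed

lemma ball_sam_defect:
  assumes "\<mu> \<in> filled_julia (sam_map p)"
  shows "in_ball E (sam_defect p \<mu>) (2 * p / (1 - p))"
  by (rule ball_ell1) (rule sum_sam_defect_le[OF p assms])

lemma not_surj_shift_op: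
  assumes "\<mu> \<in> filled_julia (sam_map p)"
  shows "shift_op (sam_op p) \<mu> ` vecs E \<noteq> vecs E"
proof
  assume "shift_op (sam_op p) \<mu> ` vecs E = vecs E"
  moreover have "sam_defect p \<mu> \<in> vecs E"
    using ball_sam_defect[OF assms] by (simp add: in_ball_def)
  ultimately obtain v where v: "v \<in> vecs E" "sam_defect p \<mu> = shift_op (sam_op p) \<mu> v"
    by blast
  then show False
    using sam_defect_not_in_range[OF _ _ vecs_null[OF v(1)], of p \<mu>] p
    by (auto simp: shift_op_def fun_eq_iff)
qed

section \<open>The resolvent outside the filled Julia set\<close>

definition resolvent_bound :: "complex \<Rightarrow> real \<Rightarrow> bool" where
  "resolvent_bound \<mu> C \<longleftrightarrow>
     (\<forall>w A. in_ball E w A \<longrightarrow> (\<exists>v. in_ball E v (C * A) \<and> shift_op (sam_op p) \<mu> v = w))"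

text \<open>The solution is the limit of the iteration \<open>x \<mapsto> (S x - w) / \<mu>\<close>, which contracts the sup
  norm and preserves a ball of \<open>E\<close>, so that completeness of \<open>E\<close> is not needed.\<close>

lemma resolvent_outside_disc:
  assumes \<mu>: "1 < cmod \<mu>"
  shows "resolvent_bound \<mu> (1 / (cmod \<mu> - 1))"
  unfolding resolvent_bound_def
proof (intro allI impI)
  fix w A assume w: "in_ball E w A"
  define r where "r = cmod \<mu>"
  \<comment> \<open>B solves (B + A) / r = B. With w rescaled to \<open>w'\<close> in the ball of
    radius B, the coefficients of the iteration have total modulus 1, so the ball is
    preserved.\<close>
  define B where "B = A / (r - 1)"
  have r: "1 < r" and A: "0 \<le> A" using \<mu> ball_nonneg[OF w] by (auto simp: r_def)
  have \<mu>0: "\<mu> \<noteq> 0" using \<mu> by auto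
  define X where "X = rec_nat (\<lambda>n::nat. 0::complex) (\<lambda>_ x n. (sam_op p x n - w n) / \<mu>)"
  have X0: "X 0 = (\<lambda>n. 0)" and XS: "X (Suc K) = (\<lambda>n. (sam_op p (X K) n - w n) / \<mu>)" for K
    by (simp_all add: X_def)
  define w' where "w' = (\<lambda>n. of_real (1 / (r - 1)) * w n)"
  have w': "in_ball E w' B"
    using ball_scale[OF w, of "of_real (1 / (r - 1))"] r
    unfolding w'_def B_def norm_of_real by simp
  have X_ball: "in_ball E (X K) B" for K
  proof (induction K)
    case 0
    show ?case
      unfolding X0 using ball_scale[OF w', of 0] ball_nonneg[OF w'] ball_mono by simp
  next
    case (Suc K)
    have "X (Suc K) = (\<lambda>n. (1 / \<mu>) * sam_op p (X K) n + (- of_real (r - 1) / \<mu>) * w' n)"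
    proof
      fix n
      have "w n = of_real (r - 1) * w' n"
        using r by (simp add: w'_def del: of_real_diff)
      moreover have "(a - k * b) / \<mu> = (1 / \<mu>) * a + (- k / \<mu>) * b" for a b k
        by (simp add: diff_divide_distrib)
      ultimately show "X (Suc K) n = (1 / \<mu>) * sam_op p (X K) n + (- of_real (r - 1) / \<mu>) * w' n"
        unfolding XS by (simp only:)
    qed
    moreover have "cmod (1 / \<mu>) + cmod (- of_real (r - 1) / \<mu>) = 1"
      using r by (simp add: norm_divide r_def[symmetric] field_simps del: of_real_diff)
    ultimately show ?case
      using ball_lincomb[OF ball_sam_op[OF Suc] w', of "1 / \<mu>" "- of_real (r - 1) / \<mu>"] by simp
  qed
  have step: "cmod (X (Suc K) n - X K n) \<le> A * (1 / r) ^ K" for K n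
  proof (induction K arbitrary: n)
    case 0
    have "cmod (w n) / r \<le> A / 1"
      using ball_sup[OF w] A r by (intro frac_le) auto
    then show ?case by (simp add: X0 XS norm_divide r_def)
  next
    case (Suc K)
    let ?d = "\<lambda>n. 1 * X (Suc K) n + (-1) * X K n"
    have e: "X (Suc (Suc K)) n = (sam_op p (X (Suc K)) n - w n) / \<mu>" "X (Suc K) n = (sam_op p (X K) n - w n) / \<mu>"
      by (rule fun_cong[OF XS])+
    have "X (Suc (Suc K)) n - X (Suc K) n = sam_op p ?d n / \<mu>"
      unfolding e sam_op_lincomb by (simp add: diff_divide_distrib)
    moreover have "cmod (sam_op p ?d n) \<le> A * (1 / r) ^ K"
      using p Suc by (intro sam_op_bound) auto
    ultimately show ?case
      using r by (simp add: norm_divide r_def[symmetric] divide_right_mono)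
  qed
  \<comment> \<open>The limit as a telescoping series; the geometric bound makes convergence
    uniform, as \<open>ball_limit\<close> requires.\<close>
  define x where "x n = (\<Sum>K. X (Suc K) n - X K n)" for n
  have "uniform_limit UNIV (\<lambda>K n. \<Sum>i<K. X (Suc i) n - X i n) x sequentially"
    unfolding x_def
  proof (rule Weierstrass_m_test)
    show "cmod (X (Suc K) n - X K n) \<le> A * (1 / r) ^ K" for K n by (rule step)
    show "summable (\<lambda>K. A * (1 / r) ^ K)"
      using r by (intro summable_mult summable_geometric) auto
  qed
  moreover have "(\<Sum>i<K. X (Suc i) n - X i n) = X K n" for K n
    using sum_lessThan_telescope[of "\<lambda>i. X i n" K] by (simp add: X0)
  ultimately have lim: "uniform_limit UNIV X x sequentially"
    by simp
  have Xx: "(\<lambda>K. X K n) \<longlonglongrightarrow> x n" for n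
    by (rule tendsto_uniform_limitI[OF lim]) simp
  have "(\<lambda>K. (sam_op p (X K) n - w n) / \<mu>) \<longlonglongrightarrow> (sam_op p x n - w n) / \<mu>" for n
    using \<mu>0 by (intro tendsto_intros sam_op_tendsto Xx)
  then have "x n = (sam_op p x n - w n) / \<mu>" for n
    using LIMSEQ_unique LIMSEQ_Suc[OF Xx[of n]] unfolding XS by blast
  then have "shift_op (sam_op p) \<mu> x = w"
    using \<mu>0 by (simp add: shift_op_def fun_eq_iff field_simps)
  moreover have "in_ball E x (1 / (cmod \<mu> - 1) * A)"
    using ball_limit[OF X_ball lim] by (simp add: B_def r_def)
  ultimately show "\<exists>v. in_ball E v (1 / (cmod \<mu> - 1) * A) \<and> shift_op (sam_op p) \<mu> v = w"
    by blast
qed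

text \<open>Solve at f(\<mu>) for (w_odd + z w_even) / p and interleave the solution with the odd
  part dictated by the even rows.\<close>

lemma resolvent_pullback:
  assumes "resolvent_bound (sam_map p \<mu>) C" and "0 \<le> C"
  shows "\<exists>D\<ge>0. resolvent_bound \<mu> D"
proof -
  let ?z = "sam_ratio p \<mu>" and ?p = "complex_of_real p"
  \<comment> \<open>\<open>c\<close> bounds the reduced right side, \<open>d\<close> dominates both
    \<open>a\<close> and the even part of \<open>w\<close>, and \<open>e\<close> then dominates both
    \<open>a\<close> and \<open>b\<close>. The summands 1 provide the common radius needed for
    combining.\<close>
  define c where "c = cmod (1 / ?p) + cmod (?z / ?p)"
  define d where "d = C * c + 1"
  define e where "e = cmod ?z + cmod (1 / ?p) + 1"
  have nonneg: "0 \<le> c" "0 \<le> d" "0 \<le> e"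
    using assms(2) by (simp_all add: c_def d_def e_def)
  have "resolvent_bound \<mu> (2 * (e * d))"
    unfolding resolvent_bound_def
  proof (intro allI impI)
    fix w A assume w: "in_ball E w A"
    then have A: "0 \<le> A" by (rule ball_nonneg)
    define w' where "w' = (\<lambda>k. (1 / ?p) * w (2 * k + 1) + (?z / ?p) * w (2 * k))"
    have "in_ball E w' (c * A)"
      unfolding w'_def c_def by (rule ball_lincomb[OF ball_odd[OF w] ball_even[OF w]])
    then obtain a where a: "in_ball E a (C * (c * A))" and eq: "shift_op (sam_op p) (sam_map p \<mu>) a = w'"
      using assms(1) unfolding resolvent_bound_def by blast
    define b where "b = (\<lambda>k. ?z * a k + w (2 * k) / ?p)"
    have "1 * A \<le> d * A" "C * (c * A) \<le> d * A"
      using A assms(2) nonneg by (simp_all add: d_def algebra_simps)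
    then have a': "in_ball E a (d * A)" and w'': "in_ball E (\<lambda>k. w (2 * k)) (d * A)"
      using ball_mono a ball_even[OF w] by auto
    have "in_ball E b ((cmod ?z + cmod (1 / ?p)) * (d * A))"
      unfolding b_def using ball_lincomb[OF a' w'', of ?z "1 / ?p"] by simp
    moreover have "(cmod ?z + cmod (1 / ?p)) * (d * A) \<le> e * (d * A)" "1 * (d * A) \<le> e * (d * A)"
      using A nonneg by (intro mult_right_mono; simp add: e_def)+
    ultimately have "in_ball E a (e * (d * A))" "in_ball E b (e * (d * A))"
      using a' ball_mono by auto
    then have "in_ball E (interleave a b) (2 * (e * (d * A)))"
      by (rule ball_interleave)
    moreover have "shift_op (sam_op p) \<mu> (interleave a b) = w"
    proof
      fix n
      have odd: "?p * (sam_op p a k - sam_map p \<mu> * a k) = w (2 * k + 1) + ?z * w (2 * k)" for k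
        using fun_cong[OF eq, of k] p by (simp add: shift_op_def w'_def field_simps)
      show "shift_op (sam_op p) \<mu> (interleave a b) n = w n"
      proof (cases "even n")
        case True
        then obtain k where "n = 2 * k" by blast
        then show ?thesis
          using sam_op_interleave(1)[where p = p and \<mu> = \<mu> and a = a and w = w and k = k] p
          by (simp add: shift_op_def b_def)
      next
        case False
        then obtain k where "n = 2 * k + 1" using oddE by blast
        then show ?thesis
          using sam_op_interleave(2)[where p = p and \<mu> = \<mu> and a = a and w = w and k = k] odd[of k] p
          by (simp add: shift_op_def b_def)
      qed
    qed
    ultimately show "\<exists>v. in_ball E v (2 * (e * d) * A) \<and> shift_op (sam_op p) \<mu> v = w"
      by (auto simp: mult.assoc)
  qed
  then show ?thesis using nonneg by (intro exI[of _ "2 * (e * d)"]) auto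
qed

lemma resolvent_outside_julia:
  assumes "\<mu> \<notin> filled_julia (sam_map p)"
  shows "\<exists>C\<ge>0. resolvent_bound \<mu> C"
proof -
  obtain i where "1 < cmod ((sam_map p ^^ i) \<mu>)"
    using assms by (auto simp: filled_julia_sam_map_iff[OF p] not_le)
  then show ?thesis
  proof (induction i arbitrary: \<mu>)
    case 0
    then show ?case
      using resolvent_outside_disc[of \<mu>] by (intro exI[of _ "1 / (cmod \<mu> - 1)"]) auto
  next
    case (Suc i)
    then have "1 < cmod ((sam_map p ^^ i) (sam_map p \<mu>))" by (simp add: funpow_swap1)
    from Suc.IH[OF this] show ?case using resolvent_pullback by blast
  qed
qed

lemma isomorphism_outside_julia:
  assumes "\<mu> \<notin> filled_julia (sam_map p)"
  shows "isomorphism_op E (shift_op (sam_op p) \<mu>)"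
proof -
  obtain C where "resolvent_bound \<mu> C" using resolvent_outside_julia[OF assms] by blast
  then show ?thesis
    using ball_nrm
    by (intro isomorphism_opI[where C = C] bounded_shift_op inj_shift_op vecs_lincomb)
      (auto simp: resolvent_bound_def in_ball_def)
qed

lemma spectrum_eq: "op_spectrum E (sam_op p) = filled_julia (sam_map p)"
  unfolding op_spectrum_def
  using isomorphism_outside_julia not_surj_shift_op isomorphism_op_image by blast

lemma point_spectrum_eq: "op_point_spectrum E (sam_op p) = {}"
  using inj_shift_op by (simp add: op_point_spectrum_def)

lemma nrm_zero: "nrm E (\<lambda>n. 0) \<le> 0"
  using ball_ell1[of "\<lambda>n. 0" 0] by (simp add: in_ball_def)

lemma dense_range_outside_julia:
  assumes "\<mu> \<notin> filled_julia (sam_map p)"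
  shows "dense_range E (shift_op (sam_op p) \<mu>)"
  unfolding dense_range_def
proof (intro ballI allI impI)
  fix w and \<epsilon> :: real assume "w \<in> vecs E" "0 < \<epsilon>"
  then obtain v where "v \<in> vecs E" "w = shift_op (sam_op p) \<mu> v"
    using isomorphism_op_image[OF isomorphism_outside_julia[OF assms]] by blast
  then show "\<exists>v\<in>vecs E. nrm E (\<lambda>n. shift_op (sam_op p) \<mu> v n - w n) < \<epsilon>"
    using nrm_zero \<open>0 < \<epsilon>\<close> by (intro bexI[of _ v]) auto
qed

end

text \<open>Small tails reduce density to finitely supported targets. The second axiom says that
  mass C spread over K positions has small norm for suitable K; in \<open>\<ell>\<^sup>1\<close> it
  would keep norm C.\<close>

locale sam_space_spread = sam_space +
  assumes ball_tail: "\<And>v \<epsilon>. v \<in> vecs E \<Longrightarrow> 0 < \<epsilon> \<Longrightarrow> \<exists>N. in_ball E (\<lambda>n. if n < N then 0 else v n) \<epsilon>"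
    and ball_spread: "\<And>C \<epsilon>. 0 \<le> C \<Longrightarrow> 0 < \<epsilon> \<Longrightarrow> \<exists>K>0. \<forall>u F. finite F \<and> card F \<le> K \<and> (\<forall>n. n \<notin> F \<longrightarrow> u n = 0) \<and>
          (\<forall>n. cmod (u n) \<le> C / real K) \<longrightarrow> in_ball E u \<epsilon>"
begin

text \<open>By \<open>unit_vector_range_sam_op\<close>, a finitely supported \<open>w\<close> is congruent, modulo the range, to a
  bounded multiple of a unit vector \<open>e\<close> at \<open>2\<^sup>N - 1\<close> for every large \<open>N\<close>. The average of
  \<open>K\<close> of these multiples has small norm.\<close>

lemma dense_range_inside_julia:
  assumes \<mu>: "\<mu> \<in> filled_julia (sam_map p)"
  shows "dense_range E (shift_op (sam_op p) \<mu>)"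
  unfolding dense_range_def
proof (intro ballI allI impI)
  fix w and \<epsilon> :: real assume w: "w \<in> vecs E" and \<epsilon>: "0 < \<epsilon>"
  \<comment> \<open>Tail and average will each have radius \<epsilon> / 4; combining them with
    coefficients -1 gives \<epsilon> / 2, strictly below \<epsilon>.\<close>
  obtain N where tail: "in_ball E (\<lambda>n. if n < N then 0 else w n) (\<epsilon> / 4)"
    using ball_tail[OF w, of "\<epsilon> / 4"] \<epsilon> by auto
  define h where "h = (\<lambda>n. if n < N then w n else 0)"
  define C where "C = (\<Sum>n<N. cmod (h n))"
  have "\<exists>c v. cmod c \<le> C \<and> v \<in> vecs E \<and>
      (\<forall>n. sam_op p v n - \<mu> * v n = h n - c * (if n = 2 ^ (N + j) - 1 then 1 else 0))" for j
  proof -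
    have N: "N \<le> 2 ^ (N + j)"
      using less_exp[of "N + j"] by linarith
    then have "h n = 0" if "2 ^ (N + j) \<le> n" for n
      using that by (simp add: h_def)
    from unit_vector_range_sam_op[OF p \<mu>, of "N + j" h, OF this] obtain c v M where
      "cmod c \<le> (\<Sum>n<2 ^ (N + j). cmod (h n))" "\<And>n. M \<le> n \<Longrightarrow> v n = 0"
      "\<And>n. sam_op p v n - \<mu> * v n = h n - c * (if n = 2 ^ (N + j) - 1 then 1 else 0)"
      by blast
    moreover have "(\<Sum>n<2 ^ (N + j). cmod (h n)) = C"
      unfolding C_def using N by (intro sum.mono_neutral_right) (auto simp: h_def)
    ultimately show ?thesis using vecs_finite_support by metis
  qed
  then obtain c v where c: "\<And>j. cmod (c j) \<le> C" and v: "\<And>j. v j \<in> vecs E"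
    and cv: "\<And>j n. sam_op p (v j) n - \<mu> * v j n = h n - c j * (if n = 2 ^ (N + j) - 1 then 1 else 0)"
    by metis
  have "0 \<le> C" unfolding C_def by (intro sum_nonneg) simp
  from ball_spread[OF this, of "\<epsilon> / 4"] \<epsilon> obtain K where K: "0 < K"
    and avg: "\<forall>u F. finite F \<and> card F \<le> K \<and> (\<forall>n. n \<notin> F \<longrightarrow> u n = 0) \<and>
          (\<forall>n. cmod (u n) \<le> C / real K) \<longrightarrow> in_ball E u (\<epsilon> / 4)"
    by auto
  define s where "s L n = (\<Sum>j<L. c j * (if n = 2 ^ (N + j) - 1 then 1 else 0))" for L and n :: nat
  have "\<exists>x\<in>vecs E. \<forall>n. sam_op p x n - \<mu> * x n = of_nat L * h n - s L n" for L
  proof (induction L)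
    case 0
    show ?case
      by (intro bexI[of _ "\<lambda>n. 0"] vecs_finite_support[of 0]) (simp_all add: s_def)
  next
    case (Suc L)
    then obtain x where x: "x \<in> vecs E" "\<And>n. sam_op p x n - \<mu> * x n = of_nat L * h n - s L n"
      by blast
    have "sam_op p (\<lambda>n. 1 * x n + 1 * v L n) n - \<mu> * (1 * x n + 1 * v L n) =
        of_nat (Suc L) * h n - s (Suc L) n" for n
    proof -
      have "sam_op p (\<lambda>n. 1 * x n + 1 * v L n) n - \<mu> * (1 * x n + 1 * v L n) =
          (sam_op p x n - \<mu> * x n) + (sam_op p (v L) n - \<mu> * v L n)"
        unfolding sam_op_lincomb by (simp add: algebra_simps)
      then show ?thesis unfolding x(2) cv by (simp add: s_def distrib_right)
    qed
    then show ?case using vecs_lincomb[OF x(1) v] by blast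
  qed
  then obtain x where x: "x \<in> vecs E" "\<And>n. sam_op p x n - \<mu> * x n = of_nat K * h n - s K n"
    by blast
  \<comment> \<open>The positions 2^(N + j) - 1 are distinct, so the summands of \<open>s\<close> do
    not overlap and every entry of the average is at most C / K.\<close>
  define u where "u = (\<lambda>n. s K n / of_nat K)"
  have u: "in_ball E u (\<epsilon> / 4)"
  proof (rule avg[rule_format, OF conjI[OF _ conjI[OF _ conjI]], rule_format])
    let ?F = "(\<lambda>j. 2 ^ (N + j) - 1) ` {..<K}"
    show "finite ?F" "card ?F \<le> K" using card_image_le[of "{..<K}"] by auto
    show zero: "u n = 0" if "n \<notin> ?F" for n
    proof -
      have "s K n = 0" unfolding s_def by (rule sum.neutral) (use that in auto)
      then show ?thesis by (simp add: u_def)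
    qed
    show "cmod (u n) \<le> C / real K" for n
    proof (cases "n \<in> ?F")
      case True
      then obtain i where i: "i < K" "n = 2 ^ (N + i) - 1" by blast
      have "n = 2 ^ (N + j) - 1 \<longleftrightarrow> j = i" for j
      proof
        assume "n = 2 ^ (N + j) - 1"
        moreover have "1 \<le> (2::nat) ^ (N + j)" "1 \<le> (2::nat) ^ (N + i)" by simp_all
        ultimately have "(2::nat) ^ (N + j) = 2 ^ (N + i)" using i(2) by linarith
        then show "j = i" by simp
      qed (use i in simp)
      then have "s K n = c i"
        unfolding s_def using i(1) by (simp add: if_distrib cong: if_cong)
      then show ?thesis
        using c[of i] by (simp add: u_def norm_divide divide_right_mono)
    qed (use zero \<open>0 \<le> C\<close> in simp)
  qed
  define y where "y = (\<lambda>n. (1 / of_nat K) * x n + 0 * x n)"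
  have y: "y \<in> vecs E" unfolding y_def by (rule vecs_lincomb) fact+
  have "(\<lambda>n. shift_op (sam_op p) \<mu> y n - w n) = (\<lambda>n. (-1) * u n + (-1) * (if n < N then 0 else w n))"
  proof
    fix n
    have "sam_op p y n - \<mu> * y n = (sam_op p x n - \<mu> * x n) / of_nat K"
      unfolding y_def sam_op_lincomb by (simp add: diff_divide_distrib)
    also have "\<dots> = h n - u n"
      unfolding x(2) using K by (simp add: u_def diff_divide_distrib)
    finally show "shift_op (sam_op p) \<mu> y n - w n = (-1) * u n + (-1) * (if n < N then 0 else w n)"
      by (simp add: shift_op_def h_def)
  qed
  then have "in_ball E (\<lambda>n. shift_op (sam_op p) \<mu> y n - w n) ((cmod (-1) + cmod (-1)) * (\<epsilon> / 4))"
    using ball_lincomb[OF u tail, of "-1" "-1"] by simp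
  then have "nrm E (\<lambda>n. shift_op (sam_op p) \<mu> y n - w n) < \<epsilon>"
    using \<epsilon> by (simp add: in_ball_def)
  with y show "\<exists>v\<in>vecs E. nrm E (\<lambda>n. shift_op (sam_op p) \<mu> v n - w n) < \<epsilon>" by blast
qed

lemma dense_range_shift_op: "dense_range E (shift_op (sam_op p) \<mu>)"
  using dense_range_inside_julia dense_range_outside_julia by blast

lemma residual_spectrum_eq: "op_residual_spectrum E (sam_op p) = {}"
  using dense_range_shift_op by (simp add: op_residual_spectrum_def)

lemma continuous_spectrum_eq: "op_continuous_spectrum E (sam_op p) = filled_julia (sam_map p)"
  unfolding op_continuous_spectrum_def
  using dense_range_shift_op inj_shift_op not_surj_shift_op
    isomorphism_op_image[OF isomorphism_outside_julia] by blast

end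

section \<open>Null sequences and summable powers\<close>

lemma sup_norm_le_iff:
  assumes "convergent v"
  shows "sup_norm v \<le> A \<longleftrightarrow> (\<forall>n. cmod (v n) \<le> A)"
proof -
  have "bdd_above (range (\<lambda>n. cmod (v n)))"
    using convergent_imp_Bseq[OF assms] by (auto simp: Bseq_def bdd_above_def)
  then show ?thesis by (simp add: sup_norm_def cSUP_le_iff)
qed

lemma in_ball_c0_iff: "in_ball c0_space v A \<longleftrightarrow> v \<longlonglongrightarrow> 0 \<and> (\<forall>n. cmod (v n) \<le> A)"
  using sup_norm_le_iff[of v A] by (auto simp: in_ball_def c0_space_def convergent_def)

lemma in_ball_c_iff: "in_ball c_space v A \<longleftrightarrow> convergent v \<and> (\<forall>n. cmod (v n) \<le> A)"
  using sup_norm_le_iff[of v A] by (auto simp: in_ball_def c_space_def)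

text \<open>Split off a finite head: its image is summable by the \<open>\<ell>\<^sup>1\<close>
  contraction, while the image of the tail is small in sup norm.\<close>

lemma sam_op_null:
  assumes p: "0 \<le> p" "p \<le> 1" and v: "v \<longlonglongrightarrow> 0"
  shows "sam_op p v \<longlonglongrightarrow> 0"
proof (rule LIMSEQ_I)
  fix e :: real assume "0 < e"
  then obtain N where N: "\<And>n. N \<le> n \<Longrightarrow> cmod (v n) < e / 2"
    using LIMSEQ_D[OF v, of "e / 2"] by auto
  define h where "h = (\<lambda>n. if n < N then v n else 0)"
  define t where "t = (\<lambda>n. if n < N then 0 else v n)"
  have "(\<Sum>n<m. cmod (sam_op p h n)) \<le> (\<Sum>n<N. cmod (h n))" for m
  proof -
    have "(\<Sum>n<m. cmod (sam_op p h n)) \<le> (\<Sum>n<2 ^ m. cmod (sam_op p h n))"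
      using less_exp[of m] by (intro sum_mono2) auto
    also have "\<dots> \<le> (\<Sum>n\<le>2 ^ m. cmod (h n))"
      by (rule sum_sam_op_le[OF p])
    also have "\<dots> \<le> (\<Sum>n<max N (2 ^ m + 1). cmod (h n))"
      by (rule sum_mono2) auto
    also have "\<dots> = (\<Sum>n<N. cmod (h n))"
      by (rule sum.mono_neutral_right) (auto simp: h_def)
    finally show ?thesis .
  qed
  then have "summable (\<lambda>n. cmod (sam_op p h n))"
    by (intro summableI_nonneg_bounded) auto
  then have "(\<lambda>n. cmod (sam_op p h n)) \<longlonglongrightarrow> 0" by (rule summable_LIMSEQ_zero)
  then obtain M where M: "\<And>n. M \<le> n \<Longrightarrow> cmod (sam_op p h n) < e / 2"
    using LIMSEQ_D[of _ 0 "e / 2"] \<open>0 < e\<close> by fastforce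
  have "v = (\<lambda>n. 1 * h n + 1 * t n)" by (auto simp: h_def t_def)
  then have split: "sam_op p v n = sam_op p h n + sam_op p t n" for n
    using sam_op_lincomb[of p 1 h 1 t n] by simp
  have "cmod (t n) \<le> e / 2" for n using N[of n] \<open>0 < e\<close> by (auto simp: t_def)
  then have t: "cmod (sam_op p t n) \<le> e / 2" for n by (rule sam_op_bound[OF p])
  have "cmod (sam_op p v n) < e" if "M \<le> n" for n
    using M[OF that] t[of n] norm_triangle_ineq[of "sam_op p h n" "sam_op p t n"] unfolding split
    by linarith
  then show "\<exists>no. \<forall>n\<ge>no. cmod (sam_op p v n - 0) < e" by auto
qed

lemma interleave_null:
  fixes a b :: "nat \<Rightarrow> complex"
  assumes "a \<longlonglongrightarrow> 0" "b \<longlonglongrightarrow> 0"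
  shows "interleave a b \<longlonglongrightarrow> 0"
proof (rule LIMSEQ_I)
  fix e :: real assume "0 < e"
  then obtain M N where M: "\<And>n. M \<le> n \<Longrightarrow> cmod (a n) < e" and N: "\<And>n. N \<le> n \<Longrightarrow> cmod (b n) < e"
    using LIMSEQ_D[OF assms(1), of e] LIMSEQ_D[OF assms(2), of e] by auto
  have "cmod (interleave a b n) < e" if "2 * (M + N) \<le> n" for n
  proof -
    have "M + N \<le> n div 2" using div_le_mono[OF that, of 2] by simp
    then show ?thesis using M[of "n div 2"] N[of "n div 2"] by (simp add: interleave_def)
  qed
  then show "\<exists>no. \<forall>n\<ge>no. cmod (interleave a b n - 0) < e" by auto
qed

lemma cmod_lincomb_le:
  assumes "cmod x \<le> A" "cmod y \<le> A"
  shows "cmod (a * x + b * y) \<le> (cmod a + cmod b) * A"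
proof -
  have "cmod (a * x + b * y) \<le> cmod a * cmod x + cmod b * cmod y"
    by (metis norm_mult norm_triangle_ineq)
  also have "\<dots> \<le> cmod a * A + cmod b * A"
    using assms by (intro add_mono mult_left_mono) auto
  finally show ?thesis by (simp add: distrib_right)
qed

section \<open>The axioms for null sequences\<close>

lemma sam_space_spread_c0:
  assumes p: "0 < p" "p < 1"
  shows "sam_space_spread p c0_space"
proof unfold_locales
  show "0 < p" "p < 1" by fact+
next
  fix v w a b A assume "in_ball c0_space v A" "in_ball c0_space w A"
  then show "in_ball c0_space (\<lambda>n. a * v n + b * w n) ((cmod a + cmod b) * A)"
    unfolding in_ball_c0_iff by (auto intro!: tendsto_eq_intros cmod_lincomb_le)
next
  fix v A assume "in_ball c0_space v A"
  moreover have "strict_mono (\<lambda>k::nat. 2 * k)" "strict_mono (\<lambda>k::nat. 2 * k + 1)"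
    by (simp_all add: strict_mono_def)
  ultimately show "in_ball c0_space (\<lambda>k. v (2 * k)) A" "in_ball c0_space (\<lambda>k. v (2 * k + 1)) A"
    unfolding in_ball_c0_iff using LIMSEQ_subseq_LIMSEQ[of v 0] by (auto simp: o_def)
next
  fix a b A assume *: "in_ball c0_space a A" "in_ball c0_space b A"
  then have "0 \<le> A" unfolding in_ball_c0_iff using norm_ge_zero order_trans by blast
  then have "cmod (a n) \<le> 2 * A" "cmod (b n) \<le> 2 * A" for n
    using * unfolding in_ball_c0_iff by (smt (verit))+
  then show "in_ball c0_space (interleave a b) (2 * A)"
    using * unfolding in_ball_c0_iff by (auto simp: interleave_def intro: interleave_null)
next
  fix v A assume "in_ball c0_space v A"
  then show "in_ball c0_space (sam_op p v) A"
    unfolding in_ball_c0_iff using p by (auto intro: sam_op_null sam_op_bound)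
next
  fix v assume "v \<in> vecs c0_space"
  then show "v \<longlonglongrightarrow> 0" by (simp add: c0_space_def)
next
  fix v A n assume "in_ball c0_space v A"
  then show "cmod (v n) \<le> A" by (simp add: in_ball_c0_iff)
next
  fix w :: "nat \<Rightarrow> complex" and A assume le: "\<And>N. (\<Sum>n<N. cmod (w n)) \<le> A"
  then have "summable (\<lambda>n. cmod (w n))" by (intro summableI_nonneg_bounded) auto
  then have "w \<longlonglongrightarrow> 0" using summable_LIMSEQ_zero tendsto_norm_zero_iff by blast
  moreover have "cmod (w n) \<le> A" for n
  proof -
    have "cmod (w n) \<le> (\<Sum>i<Suc n. cmod (w i))" by (rule member_le_sum) auto
    then show ?thesis using le[of "Suc n"] by linarith
  qed
  ultimately show "in_ball c0_space w A" by (simp add: in_ball_c0_iff)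
next
  fix X x A assume X: "\<And>K. in_ball c0_space (X K) A" and lim: "uniform_limit UNIV X x sequentially"
  have "(\<lambda>K. X K n) \<longlonglongrightarrow> x n" for n
    by (rule tendsto_uniform_limitI[OF lim]) simp
  then have "cmod (x n) \<le> A" for n
    by (rule LIMSEQ_le_const2[OF tendsto_norm]) (use X in \<open>auto simp: in_ball_c0_iff\<close>)
  \<comment> \<open>Uniform convergence permits interchanging the two limits.\<close>
  moreover have "x \<longlonglongrightarrow> 0"
    by (rule swap_uniform_limit'[where f = X and g = "\<lambda>_. 0" and F = sequentially and S = UNIV])
      (use X lim in \<open>auto simp: in_ball_c0_iff\<close>)
  ultimately show "in_ball c0_space x A" by (simp add: in_ball_c0_iff)
next
  fix v and \<epsilon> :: real assume v: "v \<in> vecs c0_space" and "0 < \<epsilon>"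
  then have "v \<longlonglongrightarrow> 0" by (simp add: c0_space_def)
  then obtain N where N: "\<And>n. N \<le> n \<Longrightarrow> cmod (v n) < \<epsilon>"
    using LIMSEQ_D[of v 0 \<epsilon>] \<open>0 < \<epsilon>\<close> by auto
  have "(\<lambda>n. if n < N then 0 else v n) \<longlonglongrightarrow> 0"
    by (rule Lim_transform_eventually[OF \<open>v \<longlonglongrightarrow> 0\<close>]) (use eventually_ge_at_top[of N] in eventually_elim, auto)
  moreover have "cmod (if n < N then 0 else v n) \<le> \<epsilon>" for n
    using N[of n] \<open>0 < \<epsilon>\<close> by auto
  ultimately show "\<exists>N. in_ball c0_space (\<lambda>n. if n < N then 0 else v n) \<epsilon>"
    unfolding in_ball_c0_iff by blast
next
  fix C \<epsilon> :: real assume "0 \<le> C" "0 < \<epsilon>"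
  obtain K where K: "C / \<epsilon> < real K" using reals_Archimedean2 by blast
  then have "0 < real K" using \<open>0 \<le> C\<close> \<open>0 < \<epsilon>\<close> by (smt (verit) divide_nonneg_pos)
  then have "C / real K \<le> \<epsilon>" using K \<open>0 < \<epsilon>\<close> by (simp add: field_simps)
  have "in_ball c0_space u \<epsilon>"
    if F: "finite F" and u: "\<forall>n. n \<notin> F \<longrightarrow> u n = 0" "\<forall>n. cmod (u n) \<le> C / real K" for u F
  proof -
    obtain m where "F \<subseteq> {..<m}" using finite_nat_bounded[OF F] by blast
    then have "0 = u n" if "m \<le> n" for n
      using u(1) that by force
    then have "\<forall>\<^sub>F n in sequentially. 0 = u n"
      unfolding eventually_sequentially by blast
    then have "u \<longlonglongrightarrow> 0" by (rule Lim_transform_eventually[OF tendsto_const])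
    then show ?thesis
      using u(2) \<open>C / real K \<le> \<epsilon>\<close> unfolding in_ball_c0_iff by (auto intro: order_trans)
  qed
  then show "\<exists>K>0. \<forall>u F. finite F \<and> card F \<le> K \<and> (\<forall>n. n \<notin> F \<longrightarrow> u n = 0) \<and>
          (\<forall>n. cmod (u n) \<le> C / real K) \<longrightarrow> in_ball c0_space u \<epsilon>"
    using \<open>0 < real K\<close> by (intro exI[of _ K]) auto
qed

text \<open>Bounding partial sums encodes both summability and the norm bound, so the axioms need
  only finite sums. \<open>0 \<le> A\<close> is explicit because for negative A the power says
  nothing about the norm.\<close>

lemma in_ball_ell_iff:
  assumes \<alpha>: "0 < \<alpha>"
  shows "in_ball (ell_space \<alpha>) v A \<longleftrightarrow> 0 \<le> A \<and> (\<forall>N. (\<Sum>n<N. cmod (v n) powr \<alpha>) \<le> A powr \<alpha>)"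
proof
  let ?f = "\<lambda>n. cmod (v n) powr \<alpha>"
  assume "in_ball (ell_space \<alpha>) v A"
  then have sm: "summable ?f" and le: "(\<Sum>n. ?f n) powr (1 / \<alpha>) \<le> A"
    by (simp_all add: in_ball_def ell_space_def)
  have "0 \<le> (\<Sum>n. ?f n)" by (intro suminf_nonneg sm) simp
  then have "(\<Sum>n. ?f n) \<le> A powr \<alpha>"
    using powr_mono2[OF _ powr_ge_zero le, of \<alpha>] \<alpha> by (simp add: powr_powr)
  moreover have "(\<Sum>n<N. ?f n) \<le> (\<Sum>n. ?f n)" for N
    by (rule sum_le_suminf[OF sm]) auto
  ultimately show "0 \<le> A \<and> (\<forall>N. (\<Sum>n<N. ?f n) \<le> A powr \<alpha>)"
    using le powr_ge_zero order_trans by blast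
next
  let ?f = "\<lambda>n. cmod (v n) powr \<alpha>"
  assume A: "0 \<le> A \<and> (\<forall>N. (\<Sum>n<N. ?f n) \<le> A powr \<alpha>)"
  then have sm: "summable ?f" by (intro summableI_nonneg_bounded[of ?f "A powr \<alpha>"]) auto
  have "(\<Sum>n. ?f n) \<le> A powr \<alpha>"
    using A by (intro suminf_le_const sm) auto
  then have "(\<Sum>n. ?f n) powr (1 / \<alpha>) \<le> (A powr \<alpha>) powr (1 / \<alpha>)"
    using \<alpha> by (intro powr_mono2 suminf_nonneg sm) auto
  also have "\<dots> = A" using \<alpha> A by (simp add: powr_powr)
  finally show "in_ball (ell_space \<alpha>) v A"
    using sm by (simp add: in_ball_def ell_space_def)
qed

lemma sam_space_ell:
  assumes p: "0 < p" "p < 1" and \<alpha>: "1 \<le> \<alpha>"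
  shows "sam_space p (ell_space \<alpha>)"
proof unfold_locales
  have \<alpha>0: "0 < \<alpha>" using \<alpha> by simp
  note iff = in_ball_ell_iff[OF \<alpha>0]
  {
    show "0 < p" "p < 1" by fact+
  next
    fix v w a b A assume v: "in_ball (ell_space \<alpha>) v A" and w: "in_ball (ell_space \<alpha>) w A"
    define s where "s = cmod a"
    define t where "t = cmod b"
    have st: "0 \<le> s" "0 \<le> t" by (simp_all add: s_def t_def)
    have A: "0 \<le> A" using v iff by blast
    have "(\<Sum>n<N. cmod (a * v n + b * w n) powr \<alpha>) \<le> ((s + t) * A) powr \<alpha>" for N
    proof -
      \<comment> \<open>Both vectors have the same radius A, so the weighted convexity bound summed
        over n replaces Minkowski.\<close>
      have "cmod (a * v n + b * w n) powr \<alpha> \<le>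
          (s + t) powr \<alpha> * ((s / (s + t)) * cmod (v n) powr \<alpha> + (t / (s + t)) * cmod (w n) powr \<alpha>)" for n
      proof -
        have "cmod (a * v n + b * w n) \<le> s * cmod (v n) + t * cmod (w n)"
          unfolding s_def t_def by (metis norm_mult norm_triangle_ineq)
        then have "cmod (a * v n + b * w n) powr \<alpha> \<le> (s * cmod (v n) + t * cmod (w n)) powr \<alpha>"
          using \<alpha>0 by (intro powr_mono2) auto
        also note powr_subconvex_combination[OF \<alpha> norm_ge_zero norm_ge_zero st]
        finally show ?thesis .
      qed
      then have "(\<Sum>n<N. cmod (a * v n + b * w n) powr \<alpha>) \<le> (\<Sum>n<N. (s + t) powr \<alpha> *
          ((s / (s + t)) * cmod (v n) powr \<alpha> + (t / (s + t)) * cmod (w n) powr \<alpha>))"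
        by (rule sum_mono)
      also have "\<dots> = (s + t) powr \<alpha> * ((s / (s + t)) * (\<Sum>n<N. cmod (v n) powr \<alpha>)
          + (t / (s + t)) * (\<Sum>n<N. cmod (w n) powr \<alpha>))"
        by (simp only: sum_distrib_left[symmetric] sum.distrib)
      also have "\<dots> \<le> (s + t) powr \<alpha> * ((s / (s + t)) * A powr \<alpha> + (t / (s + t)) * A powr \<alpha>)"
        using v w st unfolding iff by (intro mult_left_mono add_mono) auto
      also have "\<dots> = (s + t) powr \<alpha> * ((s / (s + t) + t / (s + t)) * A powr \<alpha>)"
        by (simp only: distrib_right)
      \<comment> \<open>An inequality only: for s = t = 0 both quotients are 0 and their sum is not
        1.\<close>
      also have "\<dots> \<le> (s + t) powr \<alpha> * (1 * A powr \<alpha>)"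
        by (intro mult_left_mono mult_right_mono) (simp_all add: add_divide_distrib[symmetric])
      also have "\<dots> = ((s + t) * A) powr \<alpha>"
        using st A by (simp add: powr_mult)
      finally show ?thesis .
    qed
    then show "in_ball (ell_space \<alpha>) (\<lambda>n. a * v n + b * w n) ((cmod a + cmod b) * A)"
      unfolding iff s_def t_def using A by simp
  next
    fix v A assume v: "in_ball (ell_space \<alpha>) v A"
    have "(\<Sum>n<N. cmod (v (2 * n)) powr \<alpha>) \<le> A powr \<alpha>" "(\<Sum>n<N. cmod (v (2 * n + 1)) powr \<alpha>) \<le> A powr \<alpha>" for N
    proof -
      have "(\<Sum>n<N. cmod (v (2 * n)) powr \<alpha>) + (\<Sum>n<N. cmod (v (2 * n + 1)) powr \<alpha>) \<le> A powr \<alpha>"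
        using v unfolding iff sum_even_odd[symmetric, of "\<lambda>n. cmod (v n) powr \<alpha>"] by blast
      moreover have "0 \<le> (\<Sum>n<N. cmod (v (2 * n)) powr \<alpha>)" "0 \<le> (\<Sum>n<N. cmod (v (2 * n + 1)) powr \<alpha>)"
        by (intro sum_nonneg; simp)+
      ultimately show "(\<Sum>n<N. cmod (v (2 * n)) powr \<alpha>) \<le> A powr \<alpha>"
        "(\<Sum>n<N. cmod (v (2 * n + 1)) powr \<alpha>) \<le> A powr \<alpha>" by linarith+
    qed
    then show "in_ball (ell_space \<alpha>) (\<lambda>k. v (2 * k)) A" "in_ball (ell_space \<alpha>) (\<lambda>k. v (2 * k + 1)) A"
      using v unfolding iff by blast+
  next
    fix a b A assume a: "in_ball (ell_space \<alpha>) a A" and b: "in_ball (ell_space \<alpha>) b A"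
    have "(\<Sum>n<N. cmod (interleave a b n) powr \<alpha>) \<le> (2 * A) powr \<alpha>" for N
    proof -
      have "(\<Sum>n<N. cmod (interleave a b n) powr \<alpha>) \<le> (\<Sum>n<2 * N. cmod (interleave a b n) powr \<alpha>)"
        by (rule sum_mono2) auto
      also have "\<dots> = (\<Sum>n<N. cmod (a n) powr \<alpha>) + (\<Sum>n<N. cmod (b n) powr \<alpha>)"
        by (simp add: sum_even_odd)
      also have "\<dots> \<le> A powr \<alpha> + A powr \<alpha>"
        using a b unfolding iff by (intro add_mono) auto
      also have "\<dots> = 2 powr 1 * A powr \<alpha>" by simp
      also have "\<dots> \<le> 2 powr \<alpha> * A powr \<alpha>"
        using \<alpha> by (intro mult_right_mono powr_mono) auto
      also have "\<dots> = (2 * A) powr \<alpha>"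
        using a unfolding iff by (simp add: powr_mult)
      finally show ?thesis .
    qed
    then show "in_ball (ell_space \<alpha>) (interleave a b) (2 * A)"
      using a unfolding iff by simp
  next
    fix v A assume v: "in_ball (ell_space \<alpha>) v A"
    have "(\<Sum>n<N. cmod (sam_op p v n) powr \<alpha>) \<le> A powr \<alpha>" for N
    proof -
      have "(\<Sum>n<N. cmod (sam_op p v n) powr \<alpha>) \<le> (\<Sum>n<2 ^ N. cmod (sam_op p v n) powr \<alpha>)"
        using less_exp[of N] by (intro sum_mono2) auto
      also have "\<dots> \<le> (\<Sum>n\<le>2 ^ N. cmod (v n) powr \<alpha>)"
        using p \<alpha> by (intro sum_sam_op_powr_le) auto
      also have "\<dots> \<le> A powr \<alpha>"
        using v unfolding iff lessThan_Suc_atMost[symmetric] by blast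
      finally show ?thesis .
    qed
    then show "in_ball (ell_space \<alpha>) (sam_op p v) A"
      using v unfolding iff by blast
  next
    fix v assume "v \<in> vecs (ell_space \<alpha>)"
    then have "(\<lambda>n. cmod (v n) powr \<alpha>) \<longlonglongrightarrow> 0"
      by (intro summable_LIMSEQ_zero) (simp add: ell_space_def)
    then have "(\<lambda>n. (cmod (v n) powr \<alpha>) powr (1 / \<alpha>)) \<longlonglongrightarrow> 0"
      by (rule tendsto_zero_powrI[OF _ tendsto_const]) (use \<alpha>0 in auto)
    then show "v \<longlonglongrightarrow> 0"
      using \<alpha>0 by (simp add: powr_powr tendsto_norm_zero_iff)
  next
    fix v A n assume v: "in_ball (ell_space \<alpha>) v A"
    have "cmod (v n) powr \<alpha> \<le> (\<Sum>i<Suc n. cmod (v i) powr \<alpha>)"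
      by (rule member_le_sum) auto
    also have "\<dots> \<le> A powr \<alpha>" using v unfolding iff by blast
    finally show "cmod (v n) \<le> A"
      using v powr_less_mono2[of \<alpha> A "cmod (v n)"] \<alpha>0 unfolding iff by (meson not_le)
  next
    fix w :: "nat \<Rightarrow> complex" and A assume le: "\<And>N. (\<Sum>n<N. cmod (w n)) \<le> A"
    have A: "0 \<le> A" using le[of 0] by simp
    \<comment> \<open>Every entry is at most A, so one factor is kept and the remaining power is
      bounded by that of A; summing embeds \<open>\<ell>\<^sup>1\<close> contractively.\<close>
    have "cmod (w n) powr \<alpha> \<le> cmod (w n) * A powr (\<alpha> - 1)" for n
    proof -
      have "cmod (w n) \<le> (\<Sum>i<Suc n. cmod (w i))" by (rule member_le_sum) auto
      then have "cmod (w n) \<le> A" using le[of "Suc n"] by linarith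
      then have "cmod (w n) * cmod (w n) powr (\<alpha> - 1) \<le> cmod (w n) * A powr (\<alpha> - 1)"
        using \<alpha> by (intro mult_left_mono powr_mono2) auto
      then show ?thesis by (simp add: powr_mult_base)
    qed
    then have "(\<Sum>n<N. cmod (w n) powr \<alpha>) \<le> (\<Sum>n<N. cmod (w n)) * A powr (\<alpha> - 1)" for N
      unfolding sum_distrib_right by (rule sum_mono)
    also have "(\<Sum>n<N. cmod (w n)) * A powr (\<alpha> - 1) \<le> A * A powr (\<alpha> - 1)" for N
      using le by (intro mult_right_mono) auto
    also have "A * A powr (\<alpha> - 1) = A powr \<alpha>" using A by (simp add: powr_mult_base)
    finally show "in_ball (ell_space \<alpha>) w A" unfolding iff using A by blast
  next
    fix X x A assume X: "\<And>K. in_ball (ell_space \<alpha>) (X K) A" and lim: "uniform_limit UNIV X x sequentially"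
    have "(\<lambda>K. X K n) \<longlonglongrightarrow> x n" for n
      by (rule tendsto_uniform_limitI[OF lim]) simp
    then have "(\<lambda>K. \<Sum>n<N. cmod (X K n) powr \<alpha>) \<longlonglongrightarrow> (\<Sum>n<N. cmod (x n) powr \<alpha>)" for N
      using \<alpha>0 by (intro tendsto_sum tendsto_powr' tendsto_norm tendsto_const) auto
    then have "(\<Sum>n<N. cmod (x n) powr \<alpha>) \<le> A powr \<alpha>" for N
      by (rule LIMSEQ_le_const2) (use X iff in blast)
    then show "in_ball (ell_space \<alpha>) x A" using X unfolding iff by blast
  }
qed

lemma sam_space_spread_ell:
  assumes p: "0 < p" "p < 1" and \<alpha>: "1 < \<alpha>"
  shows "sam_space_spread p (ell_space \<alpha>)"
proof -
  interpret sam_space p "ell_space \<alpha>"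
    using \<alpha> by (intro sam_space_ell p) simp
  have \<alpha>0: "0 < \<alpha>" using \<alpha> by simp
  note iff = in_ball_ell_iff[OF \<alpha>0]
  show ?thesis
  proof unfold_locales
    fix v and \<epsilon> :: real assume v: "v \<in> vecs (ell_space \<alpha>)" and \<epsilon>: "0 < \<epsilon>"
    then have "summable (\<lambda>n. cmod (v n) powr \<alpha>)" by (simp add: ell_space_def)
    then obtain N where N: "\<And>n. norm (\<Sum>i=N..<n. cmod (v i) powr \<alpha>) < \<epsilon> powr \<alpha>"
      unfolding summable_Cauchy using \<epsilon> by (metis order_refl powr_gt_zero less_numeral_extra(3))
    have "(\<Sum>n<M. cmod (if n < N then 0 else v n) powr \<alpha>) \<le> \<epsilon> powr \<alpha>" for M
    proof -
      have "(\<Sum>n<M. cmod (if n < N then 0 else v n) powr \<alpha>) = (\<Sum>i=N..<M. cmod (v i) powr \<alpha>)"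
        by (rule sum.mono_neutral_cong_right) auto
      then show ?thesis using N[of M] by simp
    qed
    then show "\<exists>N. in_ball (ell_space \<alpha>) (\<lambda>n. if n < N then 0 else v n) \<epsilon>"
      unfolding iff using \<epsilon> by (intro exI[of _ N]) auto
  next
    fix C \<epsilon> :: real assume C: "0 \<le> C" and \<epsilon>: "0 < \<epsilon>"
    \<comment> \<open>K entries of size C / K have power sum K (C / K)^\<alpha> = C^\<alpha> K^(1 -
      \<alpha>), which tends to 0 because \<alpha> > 1.\<close>
    have "(\<lambda>K. C powr \<alpha> * real K powr (1 - \<alpha>)) \<longlonglongrightarrow> C powr \<alpha> * 0"
      using \<alpha> by (intro tendsto_mult tendsto_const tendsto_neg_powr filterlim_real_sequentially) auto
    then have "\<forall>\<^sub>F K in sequentially. C powr \<alpha> * real K powr (1 - \<alpha>) < \<epsilon> powr \<alpha>"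
      using \<epsilon> by (intro order_tendstoD(2)) auto
    then obtain K where K: "C powr \<alpha> * real K powr (1 - \<alpha>) < \<epsilon> powr \<alpha>" "0 < K"
      using eventually_happens[OF eventually_conj[OF _ eventually_gt_at_top[of 0]]] by force
    have "in_ball (ell_space \<alpha>) u \<epsilon>"
      if F: "finite F" "card F \<le> K" and u: "\<forall>n. n \<notin> F \<longrightarrow> u n = 0" "\<forall>n. cmod (u n) \<le> C / real K" for u F
    proof -
      have "(\<Sum>n<N. cmod (u n) powr \<alpha>) \<le> \<epsilon> powr \<alpha>" for N
      proof -
        have "(\<Sum>n<N. cmod (u n) powr \<alpha>) = (\<Sum>n\<in>{..<N} \<inter> F. cmod (u n) powr \<alpha>)"
          by (rule sum.mono_neutral_right) (use u in auto)
        also have "\<dots> \<le> (\<Sum>n\<in>F. cmod (u n) powr \<alpha>)"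
          by (rule sum_mono2) (use F in auto)
        also have "\<dots> \<le> (\<Sum>n\<in>F. (C / real K) powr \<alpha>)"
          using u \<alpha>0 by (intro sum_mono powr_mono2) auto
        also have "\<dots> \<le> real K * (C / real K) powr \<alpha>"
          using F by (simp add: mult_right_mono)
        also have "\<dots> = C powr \<alpha> * real K powr (1 - \<alpha>)"
          using K C by (simp add: powr_divide powr_diff)
        finally show ?thesis using K by linarith
      qed
      then show ?thesis unfolding iff using \<epsilon> by simp
    qed
    then show "\<exists>K>0. \<forall>u F. finite F \<and> card F \<le> K \<and> (\<forall>n. n \<notin> F \<longrightarrow> u n = 0) \<and>
          (\<forall>n. cmod (u n) \<le> C / real K) \<longrightarrow> in_ball (ell_space \<alpha>) u \<epsilon>"
      using K(2) by (intro exI[of _ K]) auto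
  qed
qed

section \<open>Convergent sequences\<close>

text \<open>S fixes constants, so subtracting the limit reduces to null sequences.\<close>

lemma sam_op_limit:
  assumes p: "0 \<le> p" "p \<le> 1" and v: "v \<longlonglongrightarrow> l"
  shows "sam_op p v \<longlonglongrightarrow> l"
proof -
  have "(\<lambda>n. 1 * v n + (-1) * l) \<longlonglongrightarrow> 0"
    using v by (auto intro!: tendsto_eq_intros)
  from sam_op_null[OF p this] have "(\<lambda>n. sam_op p (\<lambda>n. 1 * v n + (-1) * l) n) \<longlonglongrightarrow> 0"
    by simp
  then show ?thesis
    unfolding sam_op_lincomb sam_op_const by (simp add: LIM_zero_iff)
qed

lemma shift_op_limit:
  assumes "0 \<le> p" "p \<le> 1" "v \<longlonglongrightarrow> l"
  shows "shift_op (sam_op p) \<mu> v \<longlonglongrightarrow> (1 - \<mu>) * l"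
  unfolding shift_op_def left_diff_distrib mult_1 by (intro tendsto_intros sam_op_limit assms)

text \<open>S - \<mu> multiplies constants by 1 - \<mu>. This correction carries the resolvent and
  the density of the range from null to convergent sequences.\<close>

lemma shift_op_add_const:
  assumes "\<mu> \<noteq> 1"
  shows "shift_op (sam_op p) \<mu> (\<lambda>n. v n + l / (1 - \<mu>)) = (\<lambda>n. shift_op (sam_op p) \<mu> v n + l)"
proof
  fix n
  have "shift_op (sam_op p) \<mu> (\<lambda>n. 1 * v n + 1 * c) n = shift_op (sam_op p) \<mu> v n + (1 - \<mu>) * c" for c
    unfolding shift_op_def sam_op_lincomb sam_op_const by (simp add: algebra_simps)
  from this[of "l / (1 - \<mu>)"]
  show "shift_op (sam_op p) \<mu> (\<lambda>n. v n + l / (1 - \<mu>)) n = shift_op (sam_op p) \<mu> v n + l"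
    using assms by simp
qed

lemma vecs_c_lincomb: "v \<in> vecs c_space \<Longrightarrow> w \<in> vecs c_space \<Longrightarrow> (\<lambda>n. a * v n + b * w n) \<in> vecs c_space"
  by (auto simp: c_space_def intro!: convergent_add convergent_mult convergent_const)

lemma cmod_limit_le:
  assumes "v \<longlonglongrightarrow> l" "\<And>n. cmod (v n) \<le> A"
  shows "cmod l \<le> A"
  by (rule LIMSEQ_le_const2[OF tendsto_norm[OF assms(1)]]) (use assms(2) in auto)

section \<open>The parts of the spectrum on c\<close>

context
  fixes p :: real
  assumes p: "0 < p" "p < 1"
begin

interpretation c0: sam_space_spread p c0_space
  by (rule sam_space_spread_c0[OF p])

lemma bounded_shift_op_c: "bounded_op c_space (shift_op (sam_op p) \<mu>)"
  unfolding bounded_op_def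
proof (intro conjI ballI allI exI)
  show "shift_op (sam_op p) \<mu> ` vecs c_space \<subseteq> vecs c_space"
    using shift_op_limit[of p] p by (fastforce simp: c_space_def convergent_def)
  show "shift_op (sam_op p) \<mu> (\<lambda>n. a * v n + b * w n) =
      (\<lambda>n. a * shift_op (sam_op p) \<mu> v n + b * shift_op (sam_op p) \<mu> w n)" for v w a b
    unfolding shift_op_def sam_op_lincomb by (simp add: algebra_simps)
  show "nrm c_space (shift_op (sam_op p) \<mu> v) \<le> (1 + cmod \<mu>) * nrm c_space v"
    if v: "v \<in> vecs c_space" for v
  proof -
    have le: "cmod (v n) \<le> nrm c_space v" for n
      using in_ball_c_iff[of v "nrm c_space v"] v by (simp add: in_ball_def)
    have "cmod (1 * sam_op p v n + (- \<mu>) * v n) \<le> (cmod 1 + cmod (- \<mu>)) * nrm c_space v" for n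
      using p by (intro cmod_lincomb_le sam_op_bound le) auto
    moreover have "convergent (shift_op (sam_op p) \<mu> v)"
      using v shift_op_limit[of p v] p by (auto simp: c_space_def convergent_def)
    ultimately have "in_ball c_space (shift_op (sam_op p) \<mu> v) ((1 + cmod \<mu>) * nrm c_space v)"
      unfolding in_ball_c_iff by (simp add: shift_op_def)
    then show ?thesis by (simp add: in_ball_def)
  qed
qed

text \<open>The image has limit (1 - \<mu>) l. Injectivity and non-surjectivity on c thereby reduce
  to null sequences.\<close>

lemma shift_op_null_imp_null:
  assumes "\<mu> \<noteq> 1" "v \<in> vecs c_space" "shift_op (sam_op p) \<mu> v \<longlonglongrightarrow> 0"
  shows "v \<longlonglongrightarrow> 0"
proof -
  obtain l where l: "v \<longlonglongrightarrow> l" using assms(2) by (auto simp: c_space_def convergent_def)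
  then have "(1 - \<mu>) * l = 0"
    using LIMSEQ_unique[OF shift_op_limit assms(3)] p by simp
  then show ?thesis using l assms(1) by simp
qed

lemma inj_shift_op_c:
  assumes "\<mu> \<noteq> 1"
  shows "inj_on (shift_op (sam_op p) \<mu>) (vecs c_space)"
proof (rule inj_onI)
  fix v w assume v: "v \<in> vecs c_space" and w: "w \<in> vecs c_space"
    and eq: "shift_op (sam_op p) \<mu> v = shift_op (sam_op p) \<mu> w"
  define d where "d = (\<lambda>n. 1 * v n + (-1) * w n)"
  have eig: "sam_op p d n = \<mu> * d n" for n
    using fun_cong[OF eq, of n] unfolding d_def sam_op_lincomb by (simp add: shift_op_def algebra_simps)
  have "d \<longlonglongrightarrow> 0"
  proof (rule shift_op_null_imp_null[OF assms])
    show "d \<in> vecs c_space" unfolding d_def by (rule vecs_c_lincomb[OF v w])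
    show "shift_op (sam_op p) \<mu> d \<longlonglongrightarrow> 0" unfolding shift_op_def eig by simp
  qed
  then have "d = (\<lambda>n. 0)"
    by (rule sam_op_null_eigenvector[rotated 2]) (use p eig in auto)
  then show "v = w" by (simp add: d_def fun_eq_iff)
qed

lemma not_inj_shift_op_c_one: "\<not> inj_on (shift_op (sam_op p) 1) (vecs c_space)"
proof
  have "(\<lambda>n. 1) \<in> vecs c_space" "(\<lambda>n. 0) \<in> vecs c_space"
    by (simp_all add: c_space_def convergent_const)
  moreover have "shift_op (sam_op p) 1 (\<lambda>n. 1) = shift_op (sam_op p) 1 (\<lambda>n. 0)"
    by (simp add: shift_op_def sam_op_const)
  moreover assume "inj_on (shift_op (sam_op p) 1) (vecs c_space)"
  ultimately have "(\<lambda>n::nat. 1::complex) = (\<lambda>n. 0)" by (meson inj_onD)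
  then show False by (metis zero_neq_one)
qed

lemma not_surj_shift_op_c:
  assumes \<mu>: "\<mu> \<in> filled_julia (sam_map p)" "\<mu> \<noteq> 1"
  shows "shift_op (sam_op p) \<mu> ` vecs c_space \<noteq> vecs c_space"
proof
  assume surj: "shift_op (sam_op p) \<mu> ` vecs c_space = vecs c_space"
  have null: "sam_defect p \<mu> \<longlonglongrightarrow> 0"
    using c0.ball_sam_defect[OF \<mu>(1)] by (simp add: in_ball_c0_iff)
  then have "sam_defect p \<mu> \<in> vecs c_space" by (auto simp: c_space_def convergent_def)
  with surj obtain v where v: "v \<in> vecs c_space" "sam_defect p \<mu> = shift_op (sam_op p) \<mu> v"
    by blast
  have "v \<longlonglongrightarrow> 0"
    by (rule shift_op_null_imp_null[OF \<mu>(2) v(1)]) (use null v(2) in simp)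
  from sam_defect_not_in_range[OF _ _ this, of p \<mu>] show False
    using p v(2) by (auto simp: shift_op_def fun_eq_iff)
qed

text \<open>Remove the limit, approximate among null sequences, and restore the limit by a constant.
  At \<mu> = 1 every image is null, so the range is not dense.\<close>

lemma dense_range_shift_op_c:
  assumes "\<mu> \<noteq> 1"
  shows "dense_range c_space (shift_op (sam_op p) \<mu>)"
  unfolding dense_range_def
proof (intro ballI allI impI)
  fix w and \<epsilon> :: real assume "w \<in> vecs c_space" "0 < \<epsilon>"
  then obtain l where l: "w \<longlonglongrightarrow> l" by (auto simp: c_space_def convergent_def)
  then have "(\<lambda>n. w n - l) \<in> vecs c0_space" by (simp add: c0_space_def LIM_zero_iff)
  from c0.dense_range_shift_op[of \<mu>, unfolded dense_range_def, rule_format, OF this \<open>0 < \<epsilon>\<close>]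
  obtain v where v: "v \<in> vecs c0_space" "nrm c0_space (\<lambda>n. shift_op (sam_op p) \<mu> v n - (w n - l)) < \<epsilon>"
    by blast
  show "\<exists>v\<in>vecs c_space. nrm c_space (\<lambda>n. shift_op (sam_op p) \<mu> v n - w n) < \<epsilon>"
  proof
    have "v \<longlonglongrightarrow> 0" using v(1) by (simp add: c0_space_def)
    then have "(\<lambda>n. v n + l / (1 - \<mu>)) \<longlonglongrightarrow> 0 + l / (1 - \<mu>)"
      by (intro tendsto_add tendsto_const)
    then show "(\<lambda>n. v n + l / (1 - \<mu>)) \<in> vecs c_space"
      by (auto simp: c_space_def convergent_def)
    show "nrm c_space (\<lambda>n. shift_op (sam_op p) \<mu> (\<lambda>n. v n + l / (1 - \<mu>)) n - w n) < \<epsilon>"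
      unfolding shift_op_add_const[OF assms]
      using v(2) by (simp add: c_space_def c0_space_def algebra_simps)
  qed
qed

lemma isomorphism_outside_julia_c:
  assumes \<mu>: "\<mu> \<notin> filled_julia (sam_map p)"
  shows "isomorphism_op c_space (shift_op (sam_op p) \<mu>)"
proof -
  have "\<mu> \<noteq> 1" using one_in_filled_julia[OF p] \<mu> by blast
  obtain C where C: "c0.resolvent_bound \<mu> C"
    using c0.resolvent_outside_julia[OF \<mu>] by blast
  \<comment> \<open>Removing the limit at most doubles the sup norm, giving 2 C; restoring it by a
    constant costs 1 / |1 - \<mu>|.\<close>
  let ?D = "2 * C + 1 / cmod (1 - \<mu>)"
  show ?thesis
  proof (rule isomorphism_opI[where C = ?D])
    fix w assume w: "w \<in> vecs c_space"
    define A where "A = nrm c_space w"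
    have A: "cmod (w n) \<le> A" for n
      using in_ball_c_iff[of w A] w by (simp add: in_ball_def A_def)
    obtain l where l: "w \<longlonglongrightarrow> l" using w by (auto simp: c_space_def convergent_def)
    have lA: "cmod l \<le> A" by (rule cmod_limit_le[OF l A])
    have "cmod (w n - l) \<le> 2 * A" for n
      using norm_triangle_ineq4[of "w n" l] A[of n] lA by linarith
    then have "in_ball c0_space (\<lambda>n. w n - l) (2 * A)"
      using l by (simp add: in_ball_c0_iff LIM_zero_iff)
    then obtain v where v: "in_ball c0_space v (C * (2 * A))" "shift_op (sam_op p) \<mu> v = (\<lambda>n. w n - l)"
      using C unfolding c0.resolvent_bound_def by blast
    define x where "x = (\<lambda>n. v n + l / (1 - \<mu>))"
    have "x \<longlonglongrightarrow> 0 + l / (1 - \<mu>)"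
      unfolding x_def using v(1) by (intro tendsto_add tendsto_const) (simp add: in_ball_c0_iff)
    moreover have "cmod (x n) \<le> ?D * A" for n
    proof -
      have "cmod (x n) \<le> cmod (v n) + cmod (l / (1 - \<mu>))"
        unfolding x_def by (rule norm_triangle_ineq)
      also have "\<dots> \<le> C * (2 * A) + A / cmod (1 - \<mu>)"
        using v(1) lA by (intro add_mono) (auto simp: in_ball_c0_iff norm_divide divide_right_mono)
      finally show ?thesis by (simp add: algebra_simps)
    qed
    ultimately have "in_ball c_space x (?D * A)"
      by (auto simp: in_ball_c_iff convergent_def)
    moreover have "shift_op (sam_op p) \<mu> x = w"
      unfolding x_def shift_op_add_const[OF \<open>\<mu> \<noteq> 1\<close>] v(2) by simp
    ultimately show "\<exists>v\<in>vecs c_space. shift_op (sam_op p) \<mu> v = w \<and> nrm c_space v \<le> ?D * nrm c_space w"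
      unfolding in_ball_def A_def by blast
  qed (use bounded_shift_op_c inj_shift_op_c[OF \<open>\<mu> \<noteq> 1\<close>] vecs_c_lincomb in auto)
qed

lemma spectrum_c: "op_spectrum c_space (sam_op p) = filled_julia (sam_map p)"
proof -
  \<comment> \<open>At 1 the constants lie in the kernel; elsewhere in the filled Julia set
    surjectivity fails.\<close>
  have "\<not> isomorphism_op c_space (shift_op (sam_op p) 1)"
    using not_inj_shift_op_c_one by (simp add: isomorphism_op_def bij_betw_def)
  then show ?thesis
    unfolding op_spectrum_def
    using isomorphism_outside_julia_c not_surj_shift_op_c isomorphism_op_image by blast
qed

lemma inj_shift_op_c_iff: "inj_on (shift_op (sam_op p) \<mu>) (vecs c_space) \<longleftrightarrow> \<mu> \<noteq> 1"
  using inj_shift_op_c not_inj_shift_op_c_one by metis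

lemma point_spectrum_c: "op_point_spectrum c_space (sam_op p) = {1}"
  by (simp add: op_point_spectrum_def inj_shift_op_c_iff)

lemma residual_spectrum_c: "op_residual_spectrum c_space (sam_op p) = {}"
  using dense_range_shift_op_c by (auto simp: op_residual_spectrum_def inj_shift_op_c_iff)

lemma continuous_spectrum_c: "op_continuous_spectrum c_space (sam_op p) = filled_julia (sam_map p) - {1}"
  unfolding op_continuous_spectrum_def inj_shift_op_c_iff
  using dense_range_shift_op_c not_surj_shift_op_c
    isomorphism_op_image[OF isomorphism_outside_julia_c] by blast

end

theorem theorem1:
  fixes p :: real
  assumes "0 < p" and "p < 1"
  shows
    "op_spectrum c0_space (sam_op p) = filled_julia (sam_map p) \<and>
     op_spectrum c_space (sam_op p) = filled_julia (sam_map p) \<and>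
     (\<forall>\<alpha>::real. 1 \<le> \<alpha> \<longrightarrow> op_spectrum (ell_space \<alpha>) (sam_op p) = filled_julia (sam_map p)) \<and>
     (op_continuous_spectrum c0_space (sam_op p) = filled_julia (sam_map p) \<and>
      op_point_spectrum c0_space (sam_op p) = {} \<and>
      op_residual_spectrum c0_space (sam_op p) = {}) \<and>
     (\<forall>\<alpha>::real. 1 < \<alpha> \<longrightarrow>
        op_continuous_spectrum (ell_space \<alpha>) (sam_op p) = filled_julia (sam_map p) \<and>
        op_point_spectrum (ell_space \<alpha>) (sam_op p) = {} \<and>
        op_residual_spectrum (ell_space \<alpha>) (sam_op p) = {}) \<and>
     (op_point_spectrum c_space (sam_op p) = {1} \<and>
      op_residual_spectrum c_space (sam_op p) = {} \<and>
      op_continuous_spectrum c_space (sam_op p) = filled_julia (sam_map p) - {1})"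
proof (intro conjI allI impI)
  interpret c0: sam_space_spread p c0_space
    by (rule sam_space_spread_c0[OF assms])
  show "op_spectrum c0_space (sam_op p) = filled_julia (sam_map p)"
    "op_continuous_spectrum c0_space (sam_op p) = filled_julia (sam_map p)"
    "op_point_spectrum c0_space (sam_op p) = {}"
    "op_residual_spectrum c0_space (sam_op p) = {}"
    by (rule c0.spectrum_eq c0.continuous_spectrum_eq c0.point_spectrum_eq c0.residual_spectrum_eq)+
  show "op_spectrum (ell_space \<alpha>) (sam_op p) = filled_julia (sam_map p)" if "1 \<le> \<alpha>" for \<alpha>
    by (rule sam_space.spectrum_eq[OF sam_space_ell[OF assms that]])
  show "op_continuous_spectrum (ell_space \<alpha>) (sam_op p) = filled_julia (sam_map p)"
    "op_point_spectrum (ell_space \<alpha>) (sam_op p) = {}"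
    "op_residual_spectrum (ell_space \<alpha>) (sam_op p) = {}" if "1 < \<alpha>" for \<alpha>
  proof -
    interpret ell: sam_space_spread p "ell_space \<alpha>"
      by (rule sam_space_spread_ell[OF assms that])
    show "op_continuous_spectrum (ell_space \<alpha>) (sam_op p) = filled_julia (sam_map p)"
      "op_point_spectrum (ell_space \<alpha>) (sam_op p) = {}"
      "op_residual_spectrum (ell_space \<alpha>) (sam_op p) = {}"
      by (rule ell.continuous_spectrum_eq ell.point_spectrum_eq ell.residual_spectrum_eq)+
  qed
qed (rule spectrum_c point_spectrum_c residual_spectrum_c continuous_spectrum_c; fact assms)+

end
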